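(* Let $Q$ be an acyclic quiver, let $v\in Q_0$ be a sink, and let $\mathbf{d}\in\mathbb{Z}_{\geq 0}^{Q_0}$ with $d_v=d$. Let $\overline{Q}_0:=Q_0$ and let $\overline{\mathbf{d}}\in\mathbb{Z}_{\geq 0}^{\overline{Q}_0}$ be given by $\overline{d}_v=1$ and $\overline{d}_i=d_i$ for all $i\neq v$. Let $\mathcal{A}:=\{\alpha\in Q_1 \mid t(\alpha)=v\}$, let $\overline{\mathcal{A}}:=\{\alpha^1,\dots,\alpha^d \mid \alpha\in\mathcal{A}\}$ consist of $d$ duplicates of each $\alpha\in\mathcal{A}$ (each $\alpha^k$ being an arrow with the same source and target as $\alpha$; $\overline{\mathcal{A}}=\varnothing$ if $d=0$), and let $\overline{Q}_1:=(Q_1\setminus\mathcal{A})\cup\overline{\mathcal{A}}$, giving the quiver $\overline{Q}:=(\overline{Q}_0,\overline{Q}_1)$. Then $\operatorname{rad}A_{Q,\mathbf{d}}\cong\operatorname{rad}A_{\overline{Q},\overline{\mathbf{d}}}$ (as ideals, in the sense defined in the context). In particular, $[Q,\mathbf{d}]=[\overline{Q},\overline{\mathbf{d}}]$.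
   Context: Let $\mathbb{k}=\mathbb{F}_q$ be a finite field. A quiver $Q=(Q_0,Q_1)$ consists of a finite set $Q_0$ of vertices and a finite set $Q_1$ of arrows, each arrow $\alpha$ having a source $s(\alpha)$ and a target $t(\alpha)$ in $Q_0$; multiple arrows are allowed. $Q$ is acyclic if it has no oriented cycles. A source is a vertex that is the target of no arrow; a sink is a vertex that is the source of no arrow. Paths are written left to right ($cp$ means first $c$, then $p$). For a vertex $i$, $P_Q(i)$ is the indecomposable projective representation of $Q$ over $\mathbb{k}$ at $i$: its space at vertex $j$ has as basis the set of all paths from $i$ to $j$ (including the constant path $e_i$ if $j=i$), and an arrow $\alpha:j\to k$ acts by $c\mapsto c\alpha$. For a summand vector $\mathbf{d}\in\mathbb{Z}_{\geq 0}^{Q_0}$, $P_{Q,\mathbf{d}}:=\bigoplus_{i\in Q_0}P_Q(i)^{d_i}$ and $A_{Q,\mathbf{d}}:=\operatorname{End}(P_{Q,\mathbf{d}})$ is its endomorphism algebra in the category of representations of $Q$ over $\mathbb{k}$. $\operatorname{rad}$ denotes the Jacobson radical. The count $[Q,\mathbf{d}]$ is the number of pairs $(x,y)\in\operatorname{rad}A_{Q,\mathbf{d}}\times\operatorname{rad}A_{Q,\mathbf{d}}$ with $xy=yx$. Two-sided ideals $I\unlhd A$, $J\unlhd B$ of $\mathbb{k}$-algebras are called isomorphic, $I\cong J$, if there is a bijective $\mathbb{k}$-linear map $\Psi:I\to J$ with $\Psi(i_1 i_2)=\Psi(i_1)\Psi(i_2)$ for all $i_1,i_2\in I$. *)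

theory Defs
  imports
    "HOL-Algebra.Module"
    "HOL-Algebra.Ideal"
    "HOL-Library.Poly_Mapping"
    "Graph_Theory.Arc_Walk"
begin

text \<open>
  A quiver is a \<^locale>\<open>fin_digraph\<close>: parallel arcs and loops are allowed. A path from \<open>i\<close> to \<open>j\<close>
  is a list of arcs \<open>p\<close> with \<open>awalk i p j\<close>, read left to right; the empty list is the constant path.
  Scalars form a type of class \<^class>\<open>field\<close>; vector spaces and algebras are \<open>module\<close>
  records over it.
\<close>

definition acyclic_quiver :: "('v, 'a) pre_digraph \<Rightarrow> bool" where
  "acyclic_quiver Q \<longleftrightarrow> (\<nexists>p. pre_digraph.cycle Q p)"


section \<open>Representations\<close>

record ('v, 'a, 'k, 'w) quiver_rep =
  vspace :: "'v \<Rightarrow> ('k, 'w) module"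
  arrow_map :: "'a \<Rightarrow> 'w \<Rightarrow> 'w"

definition linear_maps :: "('k, 'w) module \<Rightarrow> ('k, 'u) module \<Rightarrow> ('w \<Rightarrow> 'u) set" where
  "linear_maps V W = {f \<in> carrier V \<rightarrow>\<^sub>E carrier W.
     (\<forall>x\<in>carrier V. \<forall>y\<in>carrier V. f (x \<oplus>\<^bsub>V\<^esub> y) = f x \<oplus>\<^bsub>W\<^esub> f y) \<and>
     (\<forall>c. \<forall>x\<in>carrier V. f (c \<odot>\<^bsub>V\<^esub> x) = c \<odot>\<^bsub>W\<^esub> f x)}"

definition rep_hom ::
  "('v, 'a) pre_digraph \<Rightarrow> ('v, 'a, 'k, 'w) quiver_rep \<Rightarrow> ('v, 'a, 'k, 'u) quiver_rep
    \<Rightarrow> ('v \<Rightarrow> 'w \<Rightarrow> 'u) set" where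
  "rep_hom Q V W = {\<phi> \<in> (\<Pi>\<^sub>E j\<in>verts Q. linear_maps (vspace V j) (vspace W j)).
     \<forall>\<alpha>\<in>arcs Q. \<forall>x\<in>carrier (vspace V (tail Q \<alpha>)).
       \<phi> (head Q \<alpha>) (arrow_map V \<alpha> x) = arrow_map W \<alpha> (\<phi> (tail Q \<alpha>) x)}"

text \<open>The product \<open>\<phi>\<psi>\<close> is the composite "first \<open>\<psi>\<close>, then \<open>\<phi>\<close>".\<close>

definition rep_End ::
  "('v, 'a) pre_digraph \<Rightarrow> ('v, 'a, 'k, 'w) quiver_rep \<Rightarrow> ('k, 'v \<Rightarrow> 'w \<Rightarrow> 'w) module" where
  "rep_End Q V = \<lparr>
     carrier = rep_hom Q V V,
     monoid.mult = (\<lambda>\<phi> \<psi>. \<lambda>j\<in>verts Q. compose (carrier (vspace V j)) (\<phi> j) (\<psi> j)),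
     one = (\<lambda>j\<in>verts Q. \<lambda>x\<in>carrier (vspace V j). x),
     zero = (\<lambda>j\<in>verts Q. \<lambda>x\<in>carrier (vspace V j). \<zero>\<^bsub>vspace V j\<^esub>),
     add = (\<lambda>\<phi> \<psi>. \<lambda>j\<in>verts Q. \<lambda>x\<in>carrier (vspace V j). \<phi> j x \<oplus>\<^bsub>vspace V j\<^esub> \<psi> j x),
     smult = (\<lambda>c \<phi>. \<lambda>j\<in>verts Q. \<lambda>x\<in>carrier (vspace V j). c \<odot>\<^bsub>vspace V j\<^esub> \<phi> j x)\<rparr>"

text \<open>
  A \<open>module\<close> record extends a ring record; for plain vector spaces the
  \<open>mult\<close> and \<open>one\<close> components carry no meaning.
\<close>

definition direct_sum_rep ::
  "'i set \<Rightarrow> ('i \<Rightarrow> ('v, 'a, 'k, 'w) quiver_rep) \<Rightarrow> ('v, 'a, 'k, 'i \<Rightarrow> 'w) quiver_rep" where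
  "direct_sum_rep I V = \<lparr>
     vspace = (\<lambda>j. \<lparr>
       carrier = {x \<in> (\<Pi>\<^sub>E i\<in>I. carrier (vspace (V i) j)).
                    finite {i\<in>I. x i \<noteq> \<zero>\<^bsub>vspace (V i) j\<^esub>}},
       monoid.mult = undefined,
       one = undefined,
       zero = (\<lambda>i\<in>I. \<zero>\<^bsub>vspace (V i) j\<^esub>),
       add = (\<lambda>x y. \<lambda>i\<in>I. x i \<oplus>\<^bsub>vspace (V i) j\<^esub> y i),
       smult = (\<lambda>c x. \<lambda>i\<in>I. c \<odot>\<^bsub>vspace (V i) j\<^esub> x i)\<rparr>),
     arrow_map = (\<lambda>\<alpha> x. \<lambda>i\<in>I. arrow_map (V i) \<alpha> (x i))\<rparr>"


section \<open>Projective representations and their endomorphism algebras\<close>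

definition free_vspace :: "'b set \<Rightarrow> ('k::field, 'b \<Rightarrow>\<^sub>0 'k) module" where
  "free_vspace B = \<lparr>
     carrier = {x. Poly_Mapping.keys x \<subseteq> B},
     monoid.mult = undefined,
     one = undefined,
     zero = 0,
     add = (+),
     smult = (\<lambda>c. Poly_Mapping.map ((*) c))\<rparr>"

text \<open>The arrow \<open>\<alpha>\<close> acts by the linear extension of \<open>p \<mapsto> p \<alpha>\<close>.\<close>

definition proj_rep ::
  "('v, 'a) pre_digraph \<Rightarrow> 'v \<Rightarrow> ('v, 'a, 'k::field, 'a list \<Rightarrow>\<^sub>0 'k) quiver_rep" where
  "proj_rep Q i = \<lparr>
     vspace = (\<lambda>j. free_vspace {p. pre_digraph.awalk Q i p j}),
     arrow_map = (\<lambda>\<alpha> x. \<Sum>p\<in>Poly_Mapping.keys x. Poly_Mapping.single (p @ [\<alpha>]) (Poly_Mapping.lookup x p))\<rparr>"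

text \<open>The index \<open>(i, k)\<close> with \<open>k < d i\<close> stands for the \<open>k\<close>-th copy of the projective at \<open>i\<close>.\<close>

definition proj_sum ::
  "('v, 'a) pre_digraph \<Rightarrow> ('v \<Rightarrow> nat)
    \<Rightarrow> ('v, 'a, 'k::field, 'v \<times> nat \<Rightarrow> 'a list \<Rightarrow>\<^sub>0 'k) quiver_rep" where
  "proj_sum Q d = direct_sum_rep (SIGMA i:verts Q. {..<d i}) (\<lambda>(i, k). proj_rep Q i)"

definition proj_End ::
  "'k::field itself \<Rightarrow> ('v, 'a) pre_digraph \<Rightarrow> ('v \<Rightarrow> nat)
    \<Rightarrow> ('k, 'v \<Rightarrow> ('v \<times> nat \<Rightarrow> 'a list \<Rightarrow>\<^sub>0 'k) \<Rightarrow> ('v \<times> nat \<Rightarrow> 'a list \<Rightarrow>\<^sub>0 'k)) module" where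
  "proj_End _ Q d = rep_End Q (proj_sum Q d)"


section \<open>Jacobson radical and commuting pairs\<close>

definition left_ideal :: "'e set \<Rightarrow> ('e, 'm) ring_scheme \<Rightarrow> bool" where
  "left_ideal I R \<longleftrightarrow>
     additive_subgroup I R \<and> (\<forall>r\<in>carrier R. \<forall>x\<in>I. r \<otimes>\<^bsub>R\<^esub> x \<in> I)"

definition maximal_left_ideal :: "'e set \<Rightarrow> ('e, 'm) ring_scheme \<Rightarrow> bool" where
  "maximal_left_ideal I R \<longleftrightarrow> left_ideal I R \<and> I \<noteq> carrier R \<and>
     (\<forall>J. left_ideal J R \<and> I \<subseteq> J \<longrightarrow> J = I \<or> J = carrier R)"

text \<open>The radical of the zero ring, which has no maximal left ideals, is the whole ring.\<close>

definition jacobson_radical :: "('e, 'm) ring_scheme \<Rightarrow> 'e set" where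
  "jacobson_radical R = {x \<in> carrier R. \<forall>I. maximal_left_ideal I R \<longrightarrow> x \<in> I}"

text \<open>
  Isomorphism of an ideal \<open>I\<close> of \<open>A\<close> and an ideal \<open>J\<close> of \<open>B\<close> as algebras without unit.
\<close>

definition ideals_isomorphic ::
  "'e set \<Rightarrow> ('k, 'e) module \<Rightarrow> 'f set \<Rightarrow> ('k, 'f) module \<Rightarrow> bool" where
  "ideals_isomorphic I A J B \<longleftrightarrow> (\<exists>\<Psi>. bij_betw \<Psi> I J \<and>
     (\<forall>x\<in>I. \<forall>y\<in>I. \<Psi> (x \<oplus>\<^bsub>A\<^esub> y) = \<Psi> x \<oplus>\<^bsub>B\<^esub> \<Psi> y) \<and>
     (\<forall>c. \<forall>x\<in>I. \<Psi> (c \<odot>\<^bsub>A\<^esub> x) = c \<odot>\<^bsub>B\<^esub> \<Psi> x) \<and>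
     (\<forall>x\<in>I. \<forall>y\<in>I. \<Psi> (x \<otimes>\<^bsub>A\<^esub> y) = \<Psi> x \<otimes>\<^bsub>B\<^esub> \<Psi> y))"

definition commuting_count ::
  "'k::{field, finite} itself \<Rightarrow> ('v, 'a) pre_digraph \<Rightarrow> ('v \<Rightarrow> nat) \<Rightarrow> nat" where
  "commuting_count K Q d =
     card {(x, y) \<in> jacobson_radical (proj_End K Q d) \<times> jacobson_radical (proj_End K Q d).
             x \<otimes>\<^bsub>proj_End K Q d\<^esub> y = y \<otimes>\<^bsub>proj_End K Q d\<^esub> x}"


section \<open>Duplicating the arrows into a sink\<close>

text \<open>
  \<open>Inl \<alpha>\<close> is an arrow kept from \<open>Q\<close>, and \<open>Inr (\<alpha>, k)\<close> is the duplicate \<open>\<alpha>\<^sup>k\<close> of an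
  arrow with target \<open>v\<close>.
\<close>

definition duplicate_arrows ::
  "('v, 'a) pre_digraph \<Rightarrow> 'v \<Rightarrow> nat \<Rightarrow> ('v, 'a + 'a \<times> nat) pre_digraph" where
  "duplicate_arrows Q v n = \<lparr>
     verts = verts Q,
     arcs = Inl ` (arcs Q - in_arcs Q v) \<union> Inr ` (in_arcs Q v \<times> {1..n}),
     tail = case_sum (tail Q) (tail Q \<circ> fst),
     head = case_sum (head Q) (head Q \<circ> fst)\<rparr>"

end

theory Submission
  imports Defs "HOL-Algebra.QuotRing" "HOL-Library.Function_Algebras"
begin

text \<open>
  An endomorphism of \<open>P\<^bsub>Q,d\<^esub>\<close> is determined by the images of the generators of the summands, that is
  by a matrix of linear combinations of paths, and composition becomes convolution over the
  concatenation of paths. As \<open>Q\<close> is acyclic, the matrices without constant paths form a nilpotent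
  ideal; the quotient is semisimple, so this ideal is the radical. A nonconstant path never starts at
  the sink \<open>v\<close>, so an entry of a radical matrix involves a summand at \<open>v\<close> only as its column, i.e. at the
  end of the path; the \<open>k\<close>-th of these summands can therefore be recorded by the choice of the \<open>k\<close>-th
  duplicate of the last arrow instead.
\<close>

section \<open>Left ideals and the Jacobson radical under isomorphism\<close>

text \<open>Paths are read from left to right, so a homomorphism from the summand \<open>x\<close>
  to the summand \<open>z\<close> is a combination of paths from \<open>z\<close> to
  \<open>x\<close>: the column index is the end of the path. In a product of two radical matrices
  the middle index is the start of a nonconstant path, hence never lies at \<open>v\<close>. The
  summation therefore runs over summands that both quivers share, and replacing \<open>d v\<close>
  copies at \<open>v\<close> by one changes no product. The case \<open>d v = 0\<close> fits in: the
  new summand at \<open>v\<close> then carries only its constant path, which the radical excludes.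
  Since the radical is defined by maximal left ideals, it is bounded by them directly instead of
  through the structure of the quotient: nilpotency puts the matrices without constant paths into
  every maximal left ideal, and one maximal left ideal per column suffices to exclude everything
  else.\<close>

lemma (in ring) left_ideal_iff:
  "left_ideal I R \<longleftrightarrow> I \<subseteq> carrier R \<and> \<zero> \<in> I \<and> (\<forall>x\<in>I. \<forall>y\<in>I. x \<oplus> y \<in> I) \<and>
     (\<forall>r\<in>carrier R. \<forall>x\<in>I. r \<otimes> x \<in> I)"
proof (intro iffI conjI)
  assume I: "left_ideal I R"
  then interpret additive_subgroup I R by (simp add: left_ideal_def)
  show "I \<subseteq> carrier R" "\<zero> \<in> I" "\<forall>x\<in>I. \<forall>y\<in>I. x \<oplus> y \<in> I"
    using a_subset by auto
  show "\<forall>r\<in>carrier R. \<forall>x\<in>I. r \<otimes> x \<in> I"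
    using I by (simp add: left_ideal_def)
next
  assume *: "I \<subseteq> carrier R \<and> \<zero> \<in> I \<and> (\<forall>x\<in>I. \<forall>y\<in>I. x \<oplus> y \<in> I) \<and>
     (\<forall>r\<in>carrier R. \<forall>x\<in>I. r \<otimes> x \<in> I)"
  have "\<ominus> x \<in> I" if "x \<in> I" for x
  proof -
    \<comment> \<open>Negatives come from absorbing the factor \<open>\<ominus> \<one>\<close>, so
      closure under them follows from the other conditions.\<close>
    have "\<ominus> \<one> \<otimes> x \<in> I" using * that by auto
    moreover have "x \<in> carrier R" using * that by auto
    ultimately show ?thesis by (simp add: l_minus)
  qed
  then have "subgroup I (add_monoid R)"
    using * by (intro subgroup.intro) (auto simp: a_inv_def)
  then show "left_ideal I R"
    using * by (auto simp: left_ideal_def additive_subgroup_def)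
qed

lemma left_ideal_image:
  assumes "ring R" "ring S" "h \<in> ring_iso R S" "left_ideal I R"
  shows "left_ideal (h ` I) S"
proof -
  interpret R: ring R by fact
  interpret S: ring S by fact
  have I: "I \<subseteq> carrier R" "\<zero>\<^bsub>R\<^esub> \<in> I" "\<And>x y. x \<in> I \<Longrightarrow> y \<in> I \<Longrightarrow> x \<oplus>\<^bsub>R\<^esub> y \<in> I"
    "\<And>r x. r \<in> carrier R \<Longrightarrow> x \<in> I \<Longrightarrow> r \<otimes>\<^bsub>R\<^esub> x \<in> I"
    using assms(4) by (auto simp: R.left_ideal_iff)
  note h = ring_iso_memE[OF assms(3)]
  have h0: "h \<zero>\<^bsub>R\<^esub> = \<zero>\<^bsub>S\<^esub>"
    using assms ring_hom_zero ring_iso_def by blast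
  have "h x \<oplus>\<^bsub>S\<^esub> h y \<in> h ` I" if "x \<in> I" "y \<in> I" for x y
    using that I h(3)[of x y] by (metis image_eqI subsetD)
  moreover have "s \<otimes>\<^bsub>S\<^esub> h x \<in> h ` I" if s: "s \<in> carrier S" "x \<in> I" for s x
  proof -
    obtain r where "r \<in> carrier R" "s = h r"
      using h(5) s unfolding bij_betw_def by auto
    then show ?thesis
      using s I h(2)[of r x] by (metis image_eqI subsetD)
  qed
  ultimately show ?thesis
    using I h(1) h0[symmetric] unfolding S.left_ideal_iff by auto
qed

lemma maximal_left_ideal_image:
  assumes R: "ring R" and S: "ring S" and h: "h \<in> ring_iso R S" and I: "maximal_left_ideal I R"
  shows "maximal_left_ideal (h ` I) S"
proof -
  let ?g = "inv_into (carrier R) h"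
  have g: "?g \<in> ring_iso S R" using R h by (rule ring_iso_set_sym)
  have bij: "bij_betw h (carrier R) (carrier S)"
    using h by (simp add: ring_iso_def)
  have sub: "J \<subseteq> carrier T" if "left_ideal J T" "ring T" for J T
    using that by (simp add: ring.left_ideal_iff)
  have gh: "?g ` h ` J = J" if "J \<subseteq> carrier R" for J
    using that bij by (simp add: bij_betw_def inv_into_image_cancel)
  have hg: "h ` ?g ` J = J" if "J \<subseteq> carrier S" for J
    using that bij by (simp add: bij_betw_def image_inv_into_cancel)
  have I': "left_ideal I R" "I \<noteq> carrier R"
    "\<And>J. left_ideal J R \<Longrightarrow> I \<subseteq> J \<Longrightarrow> J = I \<or> J = carrier R"
    using I by (auto simp: maximal_left_ideal_def)
  have hR: "h ` carrier R = carrier S" and gS: "?g ` carrier S = carrier R"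
    using bij gh[of "carrier R"] by (auto simp: bij_betw_def)
  have "h ` I \<noteq> carrier S"
    using I'(1,2) sub[OF _ R] gh gS by metis
  moreover have "J = h ` I \<or> J = carrier S" if J: "left_ideal J S" "h ` I \<subseteq> J" for J
  proof -
    have "left_ideal (?g ` J) R" using left_ideal_image[OF S R g J(1)] .
    moreover have "I \<subseteq> ?g ` J"
      using image_mono[OF J(2), of ?g] gh[of I] I'(1) sub[OF _ R] by simp
    ultimately have "?g ` J = I \<or> ?g ` J = carrier R" by (rule I'(3))
    then show ?thesis
      using hg[of J] sub[OF J(1) S] hR by auto
  qed
  ultimately show ?thesis
    using left_ideal_image[OF R S h I'(1)] by (auto simp: maximal_left_ideal_def)
qed

text \<open>A maximal left ideal of \<open>S\<close> pulls back along the inverse isomorphism to a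
  maximal left ideal of \<open>R\<close>, which contains \<open>x\<close>.\<close>

lemma jacobson_radical_image_subset:
  assumes R: "ring R" and S: "ring S" and h: "h \<in> ring_iso R S"
  shows "h ` jacobson_radical R \<subseteq> jacobson_radical S"
proof clarify
  fix x assume x: "x \<in> jacobson_radical R"
  let ?g = "inv_into (carrier R) h"
  have g: "?g \<in> ring_iso S R" using R h by (rule ring_iso_set_sym)
  have bij: "bij_betw h (carrier R) (carrier S)"
    using h by (simp add: ring_iso_def)
  have "h x \<in> I" if I: "maximal_left_ideal I S" for I
  proof -
    have "x \<in> ?g ` I"
      using maximal_left_ideal_image[OF S R g I] x by (simp add: jacobson_radical_def)
    moreover have "I \<subseteq> carrier S"
      using I S by (simp add: ring.left_ideal_iff maximal_left_ideal_def)
    ultimately show ?thesis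
      using bij_betw_inv_into_right[OF bij] by auto
  qed
  then show "h x \<in> jacobson_radical S"
    using x ring_iso_memE(1)[OF h] by (simp add: jacobson_radical_def)
qed

lemma jacobson_radical_image:
  assumes R: "ring R" and S: "ring S" and h: "h \<in> ring_iso R S"
  shows "h ` jacobson_radical R = jacobson_radical S"
proof
  let ?g = "inv_into (carrier R) h"
  have g: "?g \<in> ring_iso S R" using R h by (rule ring_iso_set_sym)
  have "h ` ?g ` jacobson_radical S \<subseteq> h ` jacobson_radical R"
    using jacobson_radical_image_subset[OF S R g] by blast
  moreover have "jacobson_radical S \<subseteq> h ` carrier R"
    using h by (auto simp: ring_iso_def bij_betw_def jacobson_radical_def)
  ultimately show "jacobson_radical S \<subseteq> h ` jacobson_radical R"
    by (simp add: image_inv_into_cancel)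
qed (rule jacobson_radical_image_subset[OF assms])

section \<open>Isomorphisms of ideals as algebras without unit\<close>

lemma ideals_isomorphic_sym:
  assumes "ideals_isomorphic I A J B"
    and "\<And>x y. x \<in> I \<Longrightarrow> y \<in> I \<Longrightarrow> x \<oplus>\<^bsub>A\<^esub> y \<in> I"
    and "\<And>c x. x \<in> I \<Longrightarrow> c \<odot>\<^bsub>A\<^esub> x \<in> I"
    and "\<And>x y. x \<in> I \<Longrightarrow> y \<in> I \<Longrightarrow> x \<otimes>\<^bsub>A\<^esub> y \<in> I"
  shows "ideals_isomorphic J B I A"
proof -
  obtain \<Psi> where bij: "bij_betw \<Psi> I J"
    and \<Psi>: "\<forall>x\<in>I. \<forall>y\<in>I. \<Psi> (x \<oplus>\<^bsub>A\<^esub> y) = \<Psi> x \<oplus>\<^bsub>B\<^esub> \<Psi> y"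
      "\<forall>c. \<forall>x\<in>I. \<Psi> (c \<odot>\<^bsub>A\<^esub> x) = c \<odot>\<^bsub>B\<^esub> \<Psi> x"
      "\<forall>x\<in>I. \<forall>y\<in>I. \<Psi> (x \<otimes>\<^bsub>A\<^esub> y) = \<Psi> x \<otimes>\<^bsub>B\<^esub> \<Psi> y"
    using assms(1) unfolding ideals_isomorphic_def by blast
  let ?\<Phi> = "inv_into I \<Psi>"
  have J: "J = \<Psi> ` I" using bij by (simp add: bij_betw_def)
  have inv: "?\<Phi> (\<Psi> x) = x" if "x \<in> I" for x
    using bij that by (simp add: bij_betw_inv_into_left)
  \<comment> \<open>Undoing \<open>\<Psi>\<close> on an image requires the preimage to lie in
    \<open>I\<close>; the notion of isomorphism does not provide this, hence the closure
    hypotheses.\<close>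
  have "?\<Phi> (\<Psi> x \<oplus>\<^bsub>B\<^esub> \<Psi> y) = x \<oplus>\<^bsub>A\<^esub> y" if "x \<in> I" "y \<in> I" for x y
    using \<Psi>(1) assms(2) inv that by metis
  moreover have "?\<Phi> (c \<odot>\<^bsub>B\<^esub> \<Psi> x) = c \<odot>\<^bsub>A\<^esub> x" if "x \<in> I" for c x
    using \<Psi>(2) assms(3) inv that by metis
  moreover have "?\<Phi> (\<Psi> x \<otimes>\<^bsub>B\<^esub> \<Psi> y) = x \<otimes>\<^bsub>A\<^esub> y" if "x \<in> I" "y \<in> I" for x y
    using \<Psi>(3) assms(4) inv that by metis
  ultimately show ?thesis
    unfolding ideals_isomorphic_def using bij_betw_inv_into[OF bij]
    by (intro exI[of _ ?\<Phi>]) (simp add: J inv)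
qed

lemma ideals_isomorphic_trans [trans]:
  assumes "ideals_isomorphic I A J B" "ideals_isomorphic J B L C"
  shows "ideals_isomorphic I A L C"
proof -
  obtain f g where "bij_betw f I J" "bij_betw g J L"
    and f: "\<forall>x\<in>I. \<forall>y\<in>I. f (x \<oplus>\<^bsub>A\<^esub> y) = f x \<oplus>\<^bsub>B\<^esub> f y"
      "\<forall>c. \<forall>x\<in>I. f (c \<odot>\<^bsub>A\<^esub> x) = c \<odot>\<^bsub>B\<^esub> f x"
      "\<forall>x\<in>I. \<forall>y\<in>I. f (x \<otimes>\<^bsub>A\<^esub> y) = f x \<otimes>\<^bsub>B\<^esub> f y"
    and g: "\<forall>x\<in>J. \<forall>y\<in>J. g (x \<oplus>\<^bsub>B\<^esub> y) = g x \<oplus>\<^bsub>C\<^esub> g y"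
      "\<forall>c. \<forall>x\<in>J. g (c \<odot>\<^bsub>B\<^esub> x) = c \<odot>\<^bsub>C\<^esub> g x"
      "\<forall>x\<in>J. \<forall>y\<in>J. g (x \<otimes>\<^bsub>B\<^esub> y) = g x \<otimes>\<^bsub>C\<^esub> g y"
    using assms unfolding ideals_isomorphic_def by blast
  moreover have "f x \<in> J" if "x \<in> I" for x
    using that \<open>bij_betw f I J\<close> by (auto simp: bij_betw_def)
  ultimately show ?thesis
    unfolding ideals_isomorphic_def
    by (intro exI[of _ "g \<circ> f"] conjI bij_betw_trans[of f I J g L]) auto
qed

lemma (in ring) jacobson_radical_mult_closed:
  assumes "x \<in> carrier R" "y \<in> jacobson_radical R"
  shows "x \<otimes> y \<in> jacobson_radical R"
  using assms by (auto simp: jacobson_radical_def maximal_left_ideal_def left_ideal_def)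

text \<open>Commuting is an equation between two products in \<open>I\<close>, so
  \<open>\<Psi>\<close> preserves it and, being injective on \<open>I\<close>, also reflects it;
  applying \<open>\<Psi>\<close> to both components matches the pairs.\<close>

lemma ideals_isomorphic_card_commuting:
  assumes "ideals_isomorphic I A J B"
    and closed: "\<And>x y. x \<in> I \<Longrightarrow> y \<in> I \<Longrightarrow> x \<otimes>\<^bsub>A\<^esub> y \<in> I"
  shows "card {(x, y) \<in> I \<times> I. x \<otimes>\<^bsub>A\<^esub> y = y \<otimes>\<^bsub>A\<^esub> x} = card {(x, y) \<in> J \<times> J. x \<otimes>\<^bsub>B\<^esub> y = y \<otimes>\<^bsub>B\<^esub> x}"
proof -
  obtain \<Psi> where bij: "bij_betw \<Psi> I J"
    and mult: "\<And>x y. x \<in> I \<Longrightarrow> y \<in> I \<Longrightarrow> \<Psi> (x \<otimes>\<^bsub>A\<^esub> y) = \<Psi> x \<otimes>\<^bsub>B\<^esub> \<Psi> y"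
    using assms(1) unfolding ideals_isomorphic_def by blast
  have inj: "inj_on \<Psi> I" and J: "J = \<Psi> ` I" using bij by (auto simp: bij_betw_def)
  have comm: "x \<otimes>\<^bsub>A\<^esub> y = y \<otimes>\<^bsub>A\<^esub> x \<longleftrightarrow> \<Psi> x \<otimes>\<^bsub>B\<^esub> \<Psi> y = \<Psi> y \<otimes>\<^bsub>B\<^esub> \<Psi> x" if "x \<in> I" "y \<in> I" for x y
    using that closed mult inj by (metis inj_onD)
  have "{(x, y) \<in> J \<times> J. x \<otimes>\<^bsub>B\<^esub> y = y \<otimes>\<^bsub>B\<^esub> x} =
      map_prod \<Psi> \<Psi> ` {(x, y) \<in> I \<times> I. x \<otimes>\<^bsub>A\<^esub> y = y \<otimes>\<^bsub>A\<^esub> x}"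
    unfolding J using comm by auto
  moreover have "inj_on (map_prod \<Psi> \<Psi>) {(x, y) \<in> I \<times> I. x \<otimes>\<^bsub>A\<^esub> y = y \<otimes>\<^bsub>A\<^esub> x}"
    using inj by (auto simp: inj_on_def)
  ultimately show ?thesis by (simp add: card_image)
qed

section \<open>Convolution over concatenation of paths\<close>

text \<open>The cuts of a path; a coefficient of a product of path combinations is a sum over
  them.\<close>

definition splits :: "'a list \<Rightarrow> ('a list \<times> 'a list) set" where
  "splits r = {(q, p). q @ p = r}"

lemma splits_eq: "splits r = (\<lambda>n. (take n r, drop n r)) ` {..length r}"
proof -
  have "(q, p) \<in> (\<lambda>n. (take n r, drop n r)) ` {..length r}" if "q @ p = r" for q p
    using that by (intro image_eqI[of _ _ "length q"]) auto
  then show ?thesis by (auto simp: splits_def)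
qed

lemma finite_splits [simp]: "finite (splits r)"
  by (simp add: splits_eq)

lemma splits_Nil [simp]: "splits [] = {([], [])}"
  by (auto simp: splits_def)

text \<open>Coassociativity of cutting: both sides run over the decompositions
  \<open>r = q @ s @ t\<close>.\<close>

lemma sum_splits_nested:
  fixes h :: "'a list \<Rightarrow> 'a list \<Rightarrow> 'a list \<Rightarrow> 'b::comm_monoid_add"
  shows "(\<Sum>(q, p)\<in>splits r. \<Sum>(s, t)\<in>splits p. h q s t) = (\<Sum>(u, t)\<in>splits r. \<Sum>(q, s)\<in>splits u. h q s t)"
proof -
  have "(\<Sum>(q, p)\<in>splits r. \<Sum>(s, t)\<in>splits p. h q s t) =
      (\<Sum>x\<in>splits r. \<Sum>y\<in>splits (snd x). h (fst x) (fst y) (snd y))"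
    by (simp add: case_prod_unfold)
  also have "\<dots> = (\<Sum>(x, y)\<in>(SIGMA x:splits r. splits (snd x)). h (fst x) (fst y) (snd y))"
    by (rule sum.Sigma) auto
  also have "\<dots> = (\<Sum>(x, y)\<in>(SIGMA x:splits r. splits (fst x)). h (fst y) (snd y) (snd x))"
    by (rule sum.reindex_bij_witness[of _
          "\<lambda>((u, t), (q, s)). ((q, s @ t), (s, t))" "\<lambda>((q, p), (s, t)). ((q @ s, t), (q, s))"])
      (auto simp: splits_def)
  also have "\<dots> = (\<Sum>x\<in>splits r. \<Sum>y\<in>splits (fst x). h (fst y) (snd y) (snd x))"
    by (rule sum.Sigma[symmetric]) auto
  also have "\<dots> = (\<Sum>(u, t)\<in>splits r. \<Sum>(q, s)\<in>splits u. h q s t)"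
    by (simp add: case_prod_unfold)
  finally show ?thesis .
qed

text \<open>A cut of \<open>r @ [a]\<close> either leaves \<open>a\<close> at the end of the second
  part or has an empty second part, and \<open>g [] = 0\<close> removes the latter. This is how
  convolution meets the action of an arrow.\<close>

lemma sum_splits_snoc:
  assumes "g [] = 0"
  shows "(\<Sum>(q, p)\<in>splits (r @ [a]). f q * (g p :: 'b::semiring_0)) = (\<Sum>(q, p)\<in>splits r. f q * g (p @ [a]))"
proof -
  have "splits (r @ [a]) = insert (r @ [a], []) ((\<lambda>(q, p). (q, p @ [a])) ` splits r)"
    by (auto simp: splits_def append_eq_append_conv2 append_eq_Cons_conv image_iff)
  moreover have "(r @ [a], []) \<notin> (\<lambda>(q, p). (q, p @ [a])) ` splits r" by auto
  moreover have "inj_on (\<lambda>(q, p). (q, p @ [a])) (splits r)" by (auto simp: inj_on_def)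
  ultimately show ?thesis
    using assms by (simp add: sum.reindex case_prod_unfold)
qed

section \<open>Matrices of path combinations\<close>

lemma splits_unit_left:
  fixes r :: "'a list"
  shows "(\<Sum>(q, p)\<in>splits r. (if q = [] then a else 0) * g p) = a * (g r :: 'k::field)"
proof -
  have "(\<Sum>(q, p)\<in>splits r. (if q = [] then a else 0) * g p) =
      (\<Sum>(q, p)\<in>{([] :: 'a list, r)}. (if q = [] then a else 0) * g p)"
    by (rule sum.mono_neutral_right, rule finite_splits) (auto simp: splits_def split: if_splits)
  then show ?thesis by simp
qed

lemma splits_unit_right:
  fixes r :: "'a list"
  shows "(\<Sum>(q, p)\<in>splits r. g q * (if p = [] then a else 0)) = (g r :: 'k::field) * a"
proof -
  have "(\<Sum>(q, p)\<in>splits r. g q * (if p = [] then a else 0)) =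
      (\<Sum>(q, p)\<in>{(r, [] :: 'a list)}. g q * (if p = [] then a else 0))"
    by (rule sum.mono_neutral_right, rule finite_splits) (auto simp: splits_def split: if_splits)
  then show ?thesis by simp
qed

type_synonym ('v, 'a, 'k) path_matrix = "'v \<times> nat \<Rightarrow> 'v \<times> nat \<Rightarrow> 'a list \<Rightarrow> 'k"

locale acyclic_proj_sum = fin_digraph Q
  for Q :: "('v, 'a) pre_digraph" and d :: "'v \<Rightarrow> nat" +
  assumes acyclic: "acyclic_quiver Q"
begin

definition summands :: "('v \<times> nat) set" where
  "summands = (SIGMA i:verts Q. {..<d i})"

lemma finite_summands [simp]: "finite summands"
  by (simp add: summands_def)

section \<open>Walks in an acyclic quiver\<close>

lemma closed_awalk_Nil: "awalk u p u \<Longrightarrow> p = []"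
  using acyclic closed_w_imp_cycle[of p] by (auto simp: acyclic_quiver_def closed_w_def)

text \<open>A repeated vertex would cut out a closed walk, hence a cycle. As paths without repeated
  vertices are finite in number, so are all walks; this is the source of both finite supports and
  nilpotency.\<close>

lemma awalk_imp_apath:
  assumes "awalk u p w" shows "apath u p w"
proof (rule ccontr)
  assume "\<not> apath u p w"
  then have "\<not> distinct (awalk_verts u p)" using assms by (simp add: apath_def)
  then obtain q r s where "closed_w r"
    using awalk_not_distinct_decomp[OF assms] by (auto simp: closed_w_def)
  then show False using closed_w_imp_cycle acyclic by (auto simp: acyclic_quiver_def)
qed

lemma finite_awalks: "finite {(u, p, w). awalk u p w}"
  by (rule finite_subset[OF _ apaths_finite_triple]) (auto intro: awalk_imp_apath)

lemma finite_awalks_between: "finite {p. awalk u p w}"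
  by (rule finite_subset[OF _ apaths_finite[of u w]]) (auto intro: awalk_imp_apath)

lemma awalk_length_bounded: "\<exists>L. \<forall>u p w. awalk u p w \<longrightarrow> length p < L"
proof -
  have "finite ((\<lambda>(u, p, w). length p) ` {(u, p, w). awalk u p w})"
    using finite_awalks by (rule finite_imageI)
  then obtain L where "(\<lambda>(u, p, w). length p) ` {(u, p, w). awalk u p w} \<subseteq> {..<L}"
    using finite_nat_iff_bounded by blast
  then show ?thesis by (intro exI[of _ L]) (auto simp: image_subset_iff)
qed

text \<open>The second argument is a single column, so that one operation both multiplies matrices
  column by column and applies a matrix to the coordinates of a vector. A path \<open>p\<close> in
  the summand \<open>y\<close> is the generator moved along \<open>p\<close>, so its image under
  \<open>f\<close> has the paths \<open>q\<close> of the column \<open>f y\<close> in front of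
  \<open>p\<close>.\<close>

definition path_conv ::
  "('v, 'a, 'k::field) path_matrix \<Rightarrow> ('v \<times> nat \<Rightarrow> 'a list \<Rightarrow> 'k)
    \<Rightarrow> 'v \<times> nat \<Rightarrow> 'a list \<Rightarrow> 'k" where
  "path_conv f u = (\<lambda>z r. \<Sum>y\<in>summands. \<Sum>(q, p)\<in>splits r. f y z q * u y p)"

lemma path_conv_cong:
  "(\<And>y p. y \<in> summands \<Longrightarrow> u y p = u' y p) \<Longrightarrow> path_conv f u = path_conv f u'"
  by (auto simp: path_conv_def fun_eq_iff intro!: sum.cong)

lemma path_conv_assoc: "path_conv f (path_conv g u) = path_conv (\<lambda>x. path_conv f (g x)) u"
proof (intro ext)
  fix z r
  have "path_conv f (path_conv g u) z r =
      (\<Sum>y\<in>summands. \<Sum>w\<in>summands. \<Sum>(q, p)\<in>splits r. \<Sum>(s, t)\<in>splits p. f y z q * g w y s * u w t)"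
    unfolding path_conv_def
    by (intro sum.cong refl, subst sum.swap)
      (auto simp: sum_distrib_left case_prod_unfold mult.assoc intro!: sum.cong)
  also have "\<dots> = (\<Sum>w\<in>summands. \<Sum>y\<in>summands. \<Sum>(p, t)\<in>splits r. \<Sum>(q, s)\<in>splits p. f y z q * g w y s * u w t)"
    by (subst sum.swap) (simp add: sum_splits_nested)
  also have "\<dots> = path_conv (\<lambda>x. path_conv f (g x)) u z r"
    unfolding path_conv_def
    by (intro sum.cong refl, subst sum.swap)
      (auto simp: sum_distrib_right case_prod_unfold intro!: sum.cong)
  finally show "path_conv f (path_conv g u) z r = path_conv (\<lambda>x. path_conv f (g x)) u z r" .
qed

lemma path_conv_add_left: "path_conv (\<lambda>x z p. f x z p + g x z p) u = (\<lambda>z r. path_conv f u z r + path_conv g u z r)"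
  by (simp add: path_conv_def fun_eq_iff algebra_simps sum.distrib case_prod_unfold)

lemma path_conv_add_right: "path_conv f (\<lambda>z p. u z p + w z p) = (\<lambda>z r. path_conv f u z r + path_conv f w z r)"
  by (simp add: path_conv_def fun_eq_iff algebra_simps sum.distrib case_prod_unfold)

lemma path_conv_scale_left: "path_conv (\<lambda>x z p. c * f x z p) u = (\<lambda>z r. c * path_conv f u z r)"
  by (simp add: path_conv_def fun_eq_iff mult.assoc sum_distrib_left case_prod_unfold)

lemma path_conv_scale_right: "path_conv f (\<lambda>z p. c * u z p) = (\<lambda>z r. c * path_conv f u z r)"
  by (simp add: path_conv_def fun_eq_iff mult.left_commute sum_distrib_left case_prod_unfold)

text \<open>Supports are controlled through this one fact: walk conditions and length bounds pass
  from the factors to the product.\<close>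

lemma path_conv_nonzeroD:
  assumes "path_conv f u z r \<noteq> 0"
  shows "\<exists>y\<in>summands. \<exists>q p. r = q @ p \<and> f y z q \<noteq> 0 \<and> u y p \<noteq> 0"
proof -
  obtain y where y: "y \<in> summands" "(\<Sum>(q, p)\<in>splits r. f y z q * u y p) \<noteq> 0"
    using assms unfolding path_conv_def by (rule sum.not_neutral_contains_not_neutral)
  from y(2) obtain qp where "qp \<in> splits r" "(case qp of (q, p) \<Rightarrow> f y z q * u y p) \<noteq> 0"
    by (rule sum.not_neutral_contains_not_neutral)
  then show ?thesis using y(1) by (cases qp) (fastforce simp: splits_def)
qed

text \<open>The test \<open>x \<in> summands\<close> makes the identity matrix vanish outside the
  index set, as membership in the carrier of \<open>path_matrices\<close> demands.\<close>

definition unit_column :: "('v, 'a, 'k::field) path_matrix" where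
  "unit_column x = (\<lambda>z p. if x \<in> summands \<and> z = x \<and> p = [] then 1 else 0)"

lemma path_conv_unit_left: "path_conv unit_column u z r = (if z \<in> summands then u z r else 0)"
proof -
  have "path_conv unit_column u z r =
      (\<Sum>y\<in>summands. \<Sum>(q, p)\<in>splits r. (if q = [] then (if z = y then 1 else 0) else 0) * u y p)"
    by (auto simp: path_conv_def unit_column_def intro!: sum.cong)
  also have "\<dots> = (\<Sum>y\<in>summands. (if z = y then u z r else 0))"
    by (intro sum.cong refl) (auto simp: splits_unit_left)
  finally show ?thesis by simp
qed

lemma path_conv_unit_right: "path_conv f (unit_column x) z r = (if x \<in> summands then f x z r else 0)"
proof -
  have "path_conv f (unit_column x) z r =
      (\<Sum>y\<in>summands. \<Sum>(q, p)\<in>splits r. f y z q * (if p = [] then (if x = y then 1 else 0) else 0))"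
    by (auto simp: path_conv_def unit_column_def intro!: sum.cong)
  also have "\<dots> = (\<Sum>y\<in>summands. (if x = y then f x z r else 0))"
    by (intro sum.cong refl) (auto simp: splits_unit_right)
  finally show ?thesis by simp
qed

definition path_entry :: "'v \<times> nat \<Rightarrow> 'v \<times> nat \<Rightarrow> 'a list \<Rightarrow> bool" where
  "path_entry x z p \<longleftrightarrow> x \<in> summands \<and> z \<in> summands \<and> awalk (fst z) p (fst x)"

text \<open>
  The entry \<open>f x z p\<close> is the coefficient of the path \<open>p\<close> in the \<open>z\<close>-component of the image of the
  generator of the summand \<open>x\<close>.
\<close>

definition path_matrices :: "('k::field, ('v, 'a, 'k) path_matrix) module" where
  "path_matrices = \<lparr>
     carrier = {f. \<forall>x z p. f x z p \<noteq> 0 \<longrightarrow> path_entry x z p},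
     monoid.mult = (\<lambda>f g x. path_conv f (g x)),
     one = unit_column,
     zero = 0,
     add = (+),
     smult = (\<lambda>c f x z p. c * f x z p)\<rparr>"

lemma path_matrices_simps [simp]:
  "f \<in> carrier path_matrices \<longleftrightarrow> (\<forall>x z p. f x z p \<noteq> 0 \<longrightarrow> path_entry x z p)"
  "f \<otimes>\<^bsub>path_matrices\<^esub> g = (\<lambda>x. path_conv f (g x))"
  "\<one>\<^bsub>path_matrices\<^esub> = unit_column"
  "\<zero>\<^bsub>path_matrices\<^esub> = 0"
  "f \<oplus>\<^bsub>path_matrices\<^esub> g = f + g"
  "c \<odot>\<^bsub>path_matrices\<^esub> f = (\<lambda>x z p. c * f x z p)"
  by (simp_all add: path_matrices_def)

lemma path_entry_append: "path_entry y z q \<Longrightarrow> path_entry x y p \<Longrightarrow> path_entry x z (q @ p)"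
  by (auto simp: path_entry_def)

lemma path_entry_Nil: "path_entry x z [] \<longleftrightarrow> x \<in> summands \<and> z \<in> summands \<and> fst z = fst x"
  by (auto simp: path_entry_def awalk_Nil_iff summands_def)

declare split_paired_All [simp del] split_paired_Ex [simp del]

lemma path_matrices_one_closed: "unit_column \<in> carrier path_matrices"
  by (auto simp: unit_column_def path_entry_Nil)

lemma path_matrices_mult_closed:
  assumes "f \<in> carrier path_matrices" "g \<in> carrier path_matrices"
  shows "(\<lambda>x. path_conv f (g x)) \<in> carrier path_matrices"
proof -
  have "path_entry x z r" if "path_conv f (g x) z r \<noteq> 0" for x z r
    using path_conv_nonzeroD[OF that] assms by (metis path_entry_append path_matrices_simps(1))
  then show ?thesis by simp
qed

lemma ring_path_matrices: "ring (path_matrices :: ('k::field, _) module)"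
proof (rule ringI)
  show "abelian_group (path_matrices :: ('k, _) module)"
  proof (rule abelian_groupI)
    fix f :: "('v, 'a, 'k) path_matrix" assume "f \<in> carrier path_matrices"
    then show "\<exists>g\<in>carrier path_matrices. g \<oplus>\<^bsub>path_matrices\<^esub> f = \<zero>\<^bsub>path_matrices\<^esub>"
      by (intro bexI[of _ "- f"]) simp_all
  qed (auto simp: add_ac, metis add_0)
  show "monoid (path_matrices :: ('k, _) module)"
  proof (rule monoidI)
    fix f g h :: "('v, 'a, 'k) path_matrix"
    assume f: "f \<in> carrier path_matrices"
    show "\<one>\<^bsub>path_matrices\<^esub> \<otimes>\<^bsub>path_matrices\<^esub> f = f" "f \<otimes>\<^bsub>path_matrices\<^esub> \<one>\<^bsub>path_matrices\<^esub> = f"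
      using f by (auto simp: fun_eq_iff path_conv_unit_left path_conv_unit_right path_entry_def summands_def)
    show "(f \<otimes>\<^bsub>path_matrices\<^esub> g) \<otimes>\<^bsub>path_matrices\<^esub> h = f \<otimes>\<^bsub>path_matrices\<^esub> (g \<otimes>\<^bsub>path_matrices\<^esub> h)"
      by (simp add: path_conv_assoc)
    assume "g \<in> carrier path_matrices"
    then show "f \<otimes>\<^bsub>path_matrices\<^esub> g \<in> carrier path_matrices"
      using path_matrices_mult_closed[OF f] by simp
  qed (use path_matrices_one_closed in simp)
qed (simp_all add: fun_eq_iff plus_fun_def path_conv_add_left path_conv_add_right)

end

section \<open>The radical of the algebra of path matrices\<close>

context acyclic_proj_sum
begin

text \<open>The filtration by path length. It is multiplicative, so \<open>path_filtration m\<close>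
  contains every product of \<open>m\<close> factors from \<open>path_filtration 1\<close>; its
  vanishing for large \<open>m\<close> is the nilpotency of that ideal.\<close>

definition path_filtration :: "nat \<Rightarrow> ('v, 'a, 'k::field) path_matrix set" where
  "path_filtration m = {f \<in> carrier path_matrices. \<forall>x z p. f x z p \<noteq> 0 \<longrightarrow> m \<le> length p}"

lemma path_filtration_mult:
  assumes f: "f \<in> path_filtration m" and g: "g \<in> path_filtration n"
  shows "(\<lambda>x. path_conv f (g x)) \<in> path_filtration (m + n)"
proof -
  have "m + n \<le> length r" if nz: "path_conv f (g x) z r \<noteq> 0" for x z r
  proof -
    obtain q p y where "r = q @ p" "f y z q \<noteq> 0" "g x y p \<noteq> 0"
      using path_conv_nonzeroD[OF nz] by blast
    moreover from this have "m \<le> length q" "n \<le> length p"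
      using f g by (auto simp: path_filtration_def)
    ultimately show ?thesis by simp
  qed
  then show ?thesis
    using path_matrices_mult_closed[of f g] f g unfolding path_filtration_def by blast
qed

lemma path_filtration_0: "path_filtration 0 = carrier path_matrices"
  by (auto simp: path_filtration_def)

lemma path_filtration_zero: "0 \<in> path_filtration m"
  by (simp add: path_filtration_def)

lemma path_filtration_add: "f \<in> path_filtration m \<Longrightarrow> g \<in> path_filtration m \<Longrightarrow> f + g \<in> path_filtration m"
proof -
  have "f x z p \<noteq> 0 \<or> g x z p \<noteq> 0" if "(f + g) x z p \<noteq> 0" for x z p
    using that by auto
  moreover assume "f \<in> path_filtration m" "g \<in> path_filtration m"
  ultimately show ?thesis unfolding path_filtration_def path_matrices_simps mem_Collect_eq by blast
qed

lemma path_filtration_scale: "f \<in> path_filtration m \<Longrightarrow> (\<lambda>x z p. c * f x z p) \<in> path_filtration m"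
  by (auto simp: path_filtration_def)

lemma path_filtration_eventually_zero:
  "\<exists>L. path_filtration L = ({0} :: ('v, 'a, 'k::field) path_matrix set)"
proof -
  obtain L where "\<forall>u p w. awalk u p w \<longrightarrow> length p < L"
    using awalk_length_bounded by blast
  then have "path_filtration L = ({0} :: ('v, 'a, 'k) path_matrix set)"
  proof -
    have "f = 0" if "f \<in> path_filtration L" for f :: "('v, 'a, 'k) path_matrix"
    proof (intro ext, rule ccontr)
      fix x z p assume "f x z p \<noteq> 0 x z p"
      then have "path_entry x z p" "L \<le> length p"
        using that by (auto simp: path_filtration_def)
      then show False
        using \<open>\<forall>u p w. awalk u p w \<longrightarrow> length p < L\<close> leD unfolding path_entry_def by blast
    qed
    then show ?thesis using path_filtration_zero[of L] by blast
  qed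
  then show ?thesis ..
qed

lemma path_matrices_unit_right:
  "f \<in> carrier path_matrices \<Longrightarrow> (\<lambda>x. path_conv f (unit_column x)) = f"
  by (auto simp: fun_eq_iff path_conv_unit_right path_entry_def)

lemma path_matrices_add_right:
  "(\<lambda>x. path_conv f ((g + h) x)) = (\<lambda>x. path_conv f (g x)) + (\<lambda>x. path_conv f (h x))"
  by (simp add: plus_fun_def path_conv_add_right)

lemma left_ideal_path_matrices_iff:
  "left_ideal J path_matrices \<longleftrightarrow> J \<subseteq> carrier path_matrices \<and> 0 \<in> J \<and>
     (\<forall>f\<in>J. \<forall>g\<in>J. f + g \<in> J) \<and>
     (\<forall>f\<in>carrier path_matrices. \<forall>g\<in>J. (\<lambda>x. path_conv f (g x)) \<in> J)"
  by (simp add: ring.left_ideal_iff[OF ring_path_matrices])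

lemma left_ideal_unit_eq_carrier:
  assumes "left_ideal J path_matrices" "unit_column \<in> J"
  shows "J = carrier path_matrices"
proof -
  have "f \<in> J" if "f \<in> carrier path_matrices" for f
  proof -
    have "(\<lambda>x. path_conv f (unit_column x)) \<in> J"
      using assms that unfolding left_ideal_path_matrices_iff by blast
    then show ?thesis by (simp only: path_matrices_unit_right[OF that])
  qed
  then show ?thesis using assms unfolding left_ideal_path_matrices_iff by blast
qed

text \<open>
  If \<open>1 = j + n\<close> with \<open>j\<close> in the left ideal \<open>J\<close> and \<open>n\<close> of positive path length, then multiplying the
  error term by this equation pushes it ever deeper into the filtration.
\<close>

lemma path_filtration_1_subset_maximal:
  fixes J :: "('v, 'a, 'k::field) path_matrix set"
  assumes J: "maximal_left_ideal J path_matrices"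
  shows "path_filtration 1 \<subseteq> J"
proof (rule ccontr)
  assume not_sub: "\<not> path_filtration 1 \<subseteq> J"
  have JL: "left_ideal J path_matrices" and J_ne: "J \<noteq> carrier path_matrices"
    using J by (auto simp: maximal_left_ideal_def)
  have J_sub: "J \<subseteq> carrier path_matrices" and J0: "0 \<in> J" and J_add: "\<And>f g. f \<in> J \<Longrightarrow> g \<in> J \<Longrightarrow> f + g \<in> J"
    and J_mult: "\<And>f g. f \<in> carrier path_matrices \<Longrightarrow> g \<in> J \<Longrightarrow> (\<lambda>x. path_conv f (g x)) \<in> J"
    using JL by (auto simp: left_ideal_path_matrices_iff)
  have N_mult: "(\<lambda>x. path_conv f (n x)) \<in> path_filtration 1"
    if "f \<in> carrier path_matrices" "n \<in> path_filtration 1" for f n :: "('v, 'a, 'k) path_matrix"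
    using path_filtration_mult[of f 0 n 1] that by (simp add: path_filtration_0)
  have F_sub: "path_filtration m \<subseteq> (carrier path_matrices :: ('v, 'a, 'k) path_matrix set)" for m
    by (auto simp: path_filtration_def)
  \<comment> \<open>The sum of the two left ideals; if it exceeds \<open>J\<close>, maximality makes
    it everything, and the identity decomposes.\<close>
  define S where "S = {j + n | j n. j \<in> J \<and> n \<in> path_filtration 1}"
  have "left_ideal S path_matrices"
    unfolding left_ideal_path_matrices_iff
  proof (intro conjI ballI)
    show "S \<subseteq> carrier path_matrices"
      using J_sub F_sub[of 1] path_filtration_add[of _ 0] unfolding S_def path_filtration_0 by blast
    show "0 \<in> S"
      using J0 path_filtration_zero[of 1] unfolding S_def by (metis (mono_tags, lifting) add_0 mem_Collect_eq)
  next
    fix f g :: "('v, 'a, 'k) path_matrix" assume "f \<in> S" "g \<in> S"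
    then obtain j n j' n' where *: "f = j + n" "g = j' + n'" "j \<in> J" "j' \<in> J"
      "n \<in> path_filtration 1" "n' \<in> path_filtration 1"
      unfolding S_def by blast
    then have "f + g = (j + j') + (n + n')" by (simp add: add_ac)
    then show "f + g \<in> S"
      unfolding S_def using * J_add path_filtration_add by blast
  next
    fix f g :: "('v, 'a, 'k) path_matrix" assume f: "f \<in> carrier path_matrices" and "g \<in> S"
    then obtain j n where "g = j + n" "j \<in> J" "n \<in> path_filtration 1"
      unfolding S_def by blast
    then show "(\<lambda>x. path_conv f (g x)) \<in> S"
      unfolding S_def using f J_mult N_mult path_matrices_add_right by blast
  qed
  moreover have J_S: "J \<subseteq> S"
    using path_filtration_zero[of 1] unfolding S_def by (force intro: add_0_right[symmetric])
  moreover have "path_filtration 1 \<subseteq> S"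
    using J0 unfolding S_def by (force intro: add_0[symmetric])
  ultimately have "S = carrier path_matrices"
    using J not_sub unfolding maximal_left_ideal_def by blast
  then have "unit_column \<in> S" using path_matrices_one_closed by blast
  then obtain j n where j: "j \<in> J" and n: "n \<in> path_filtration 1" and jn: "unit_column = j + n"
    unfolding S_def by blast
  have "\<exists>j\<in>J. \<exists>f\<in>path_filtration m. unit_column = j + f" for m
  proof (induction m)
    case 0
    show ?case
      using J0 path_matrices_one_closed unfolding path_filtration_0
      by (intro bexI[of _ 0] bexI[of _ unit_column]) simp_all
  next
    case (Suc m)
    then obtain j' f where j': "j' \<in> J" and f: "f \<in> path_filtration m" and e: "unit_column = j' + f"
      by blast
    have fc: "f \<in> carrier path_matrices" using f F_sub by blast
    have "f = (\<lambda>x. path_conv f (j x)) + (\<lambda>x. path_conv f (n x))"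
      using path_matrices_unit_right[OF fc] unfolding jn path_matrices_add_right by (rule sym)
    then have "unit_column = (j' + (\<lambda>x. path_conv f (j x))) + (\<lambda>x. path_conv f (n x))"
      using e by (simp add: add.assoc)
    moreover have "(\<lambda>x. path_conv f (n x)) \<in> path_filtration (Suc m)"
      using path_filtration_mult[OF f n] by simp
    moreover have "j' + (\<lambda>x. path_conv f (j x)) \<in> J"
      using J_add J_mult j j' fc by blast
    ultimately show ?case by blast
  qed
  moreover obtain L where "path_filtration L = ({0} :: ('v, 'a, 'k) path_matrix set)"
    using path_filtration_eventually_zero by blast
  \<comment> \<open>At depth \<open>L\<close> the error term is zero.\<close>
  ultimately have "unit_column \<in> J" by (metis add_0_right singletonD)
  then show False using left_ideal_unit_eq_carrier[OF JL] J_ne by blast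
qed

text \<open>
  The matrices whose \<open>x\<close>-th column has no constant paths form a maximal left ideal: modulo it, the
  algebra acts on the top of the summand \<open>x\<close>.
\<close>

lemma maximal_left_ideal_column:
  assumes x: "x \<in> summands"
  defines "J \<equiv> {f \<in> carrier path_matrices :: ('v, 'a, 'k::field) path_matrix set. \<forall>z. f x z [] = 0}"
  shows "maximal_left_ideal J path_matrices"
proof -
  \<comment> \<open>The empty path has a single cut, so constant coefficients multiply like ordinary
    matrices.\<close>
  have conv_Nil: "path_conv f u z [] = (\<Sum>y\<in>summands. f y z [] * u y [])"
    for f :: "('v, 'a, 'k) path_matrix" and u z
    by (simp add: path_conv_def)
  have J: "left_ideal J path_matrices"
    unfolding left_ideal_path_matrices_iff
  proof (intro conjI ballI)
    fix f g :: "('v, 'a, 'k) path_matrix" assume "f \<in> J" "g \<in> J"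
    then show "f + g \<in> J"
      using path_filtration_add[of f 0 g] by (simp add: J_def path_filtration_0)
  next
    fix f g :: "('v, 'a, 'k) path_matrix" assume "f \<in> carrier path_matrices" "g \<in> J"
    then show "(\<lambda>y. path_conv f (g y)) \<in> J"
      using path_matrices_mult_closed[of f g] by (simp add: J_def conv_Nil)
  qed (auto simp: J_def)
  have "unit_column \<notin> J" using x by (auto simp: J_def unit_column_def)
  then have "J \<noteq> carrier path_matrices" using path_matrices_one_closed by blast
  moreover have "S = J \<or> S = carrier path_matrices"
    if S: "left_ideal S path_matrices" "J \<subseteq> S" for S
  proof (rule disjCI)
    assume "S \<noteq> carrier path_matrices"
    show "S = J"
    proof (rule ccontr)
      assume "S \<noteq> J"
      then obtain g where g: "g \<in> S" "g \<notin> J" using S by blast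
      have gc: "g \<in> carrier path_matrices"
        using g S by (auto simp: left_ideal_path_matrices_iff)
      then obtain y where y: "g x y [] \<noteq> 0" using g by (auto simp: J_def)
      then have xy: "y \<in> summands" "fst y = fst x" using gc path_entry_Nil unfolding path_matrices_simps by blast+
      \<comment> \<open>A scaled matrix unit that moves the pivot \<open>g x y []\<close> to row
        \<open>x\<close> with value \<open>1\<close>; the constant path is a legal entry there
        because \<open>fst y = fst x\<close>.\<close>
      define e :: "('v, 'a, 'k) path_matrix" where "e = (\<lambda>a b p. if a = y \<and> b = x \<and> p = [] then inverse (g x y []) else 0)"
      define h where "h = (\<lambda>a. path_conv e (g a))"
      have e: "e \<in> carrier path_matrices" "(\<lambda>a b p. - e a b p) \<in> carrier path_matrices"
        using x xy by (auto simp: e_def path_entry_Nil)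
      have h: "h \<in> S" "(\<lambda>a. path_conv (\<lambda>a b p. - e a b p) (g a)) \<in> S"
        using S(1) g(1) e unfolding left_ideal_path_matrices_iff h_def by blast+
      have neg: "(\<lambda>a. path_conv (\<lambda>a b p. - e a b p) (g a)) = - h"
        using path_conv_scale_left[of "-1" e] by (simp add: h_def fun_eq_iff)
      have hx: "h x z [] = (if z = x then 1 else 0)" for z
      proof -
        have "h x z [] = (\<Sum>w\<in>summands. if w = y then (if z = x then 1 else 0) else 0)"
          unfolding h_def conv_Nil using y by (intro sum.cong) (auto simp: e_def)
        then show ?thesis using xy by simp
      qed
      have "- h \<in> carrier path_matrices" "h \<in> carrier path_matrices"
        using h S(1) neg by (auto simp: left_ideal_path_matrices_iff)
      then have "unit_column - h \<in> carrier path_matrices"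
        using path_filtration_add[of unit_column 0 "- h"] path_matrices_one_closed
        by (simp add: path_filtration_0)
      \<comment> \<open>In column \<open>x\<close> both matrices have the same constant part, namely
        \<open>1\<close> in row \<open>x\<close>. With \<open>h \<in> S\<close> this puts the
        identity into \<open>S\<close>.\<close>
      then have "unit_column - h \<in> J"
        using x hx by (auto simp: J_def unit_column_def)
      then have "unit_column - h + h \<in> S"
        using S h unfolding left_ideal_path_matrices_iff by blast
      then have "unit_column \<in> S" by simp
      then show False
        using left_ideal_unit_eq_carrier[OF S(1)] \<open>S \<noteq> carrier path_matrices\<close> by blast
    qed
  qed
  ultimately show ?thesis using J by (auto simp: maximal_left_ideal_def)
qed

definition path_radical :: "('v, 'a, 'k::field) path_matrix set" where
  "path_radical = {f \<in> carrier path_matrices. \<forall>x z. f x z [] = 0}"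

lemma path_filtration_1: "path_filtration 1 = (path_radical :: ('v, 'a, 'k::field) path_matrix set)"
proof -
  have "(\<forall>x z p. f x z p \<noteq> 0 \<longrightarrow> 1 \<le> length p) \<longleftrightarrow> (\<forall>x z. f x z [] = 0)"
    for f :: "('v, 'a, 'k) path_matrix"
    by (metis One_nat_def Suc_le_eq length_greater_0_conv)
  then show ?thesis by (simp only: path_filtration_def path_radical_def)
qed

lemma path_radical_closed:
  assumes "f \<in> path_radical"
  shows "f \<in> carrier path_matrices"
    and "g \<in> path_radical \<Longrightarrow> f + g \<in> path_radical"
    and "(\<lambda>x z p. c * f x z p) \<in> path_radical"
    and "g \<in> path_radical \<Longrightarrow> (\<lambda>x. path_conv f (g x)) \<in> path_radical"
proof -
  show f: "f \<in> carrier path_matrices" using assms unfolding path_radical_def by blast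
  show "g \<in> path_radical \<Longrightarrow> f + g \<in> path_radical"
    using assms unfolding path_filtration_1[symmetric] by (rule path_filtration_add)
  show "(\<lambda>x z p. c * f x z p) \<in> path_radical"
    using assms unfolding path_filtration_1[symmetric] by (rule path_filtration_scale)
  show "(\<lambda>x. path_conv f (g x)) \<in> path_radical" if "g \<in> path_radical"
    using path_filtration_mult[of f 0 g 1] f that unfolding path_filtration_0 path_filtration_1 by (simp only: add_0 path_filtration_1)
qed

text \<open>Two bounds meet: every maximal left ideal contains \<open>path_radical\<close>, and the
  ideals of \<open>maximal_left_ideal_column\<close> intersect in it, since columns outside
  \<open>summands\<close> are zero.\<close>

lemma jacobson_radical_path_matrices:
  "jacobson_radical path_matrices = (path_radical :: ('v, 'a, 'k::field) path_matrix set)"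
proof
  show "path_radical \<subseteq> jacobson_radical (path_matrices :: ('k, _) module)"
  proof
    fix f :: "('v, 'a, 'k) path_matrix"
    assume f: "f \<in> path_radical"
    then have "f \<in> carrier path_matrices" unfolding path_radical_def by blast
    moreover have "f \<in> I" if "maximal_left_ideal I path_matrices" for I
      using path_filtration_1_subset_maximal[OF that, unfolded path_filtration_1] f by (rule subsetD)
    ultimately show "f \<in> jacobson_radical path_matrices"
      unfolding jacobson_radical_def mem_Collect_eq by blast
  qed
  show "jacobson_radical (path_matrices :: ('k, _) module) \<subseteq> path_radical"
  proof
    fix f :: "('v, 'a, 'k) path_matrix"
    assume f: "f \<in> jacobson_radical path_matrices"
    then have fc: "f \<in> carrier path_matrices" by (simp add: jacobson_radical_def)
    moreover have "f x z [] = 0" for x z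
    proof (cases "x \<in> summands")
      case True
      then show ?thesis
        using maximal_left_ideal_column[OF True] f unfolding jacobson_radical_def by blast
    next
      case False
      then show ?thesis using fc path_entry_def by auto
    qed
    ultimately show "f \<in> path_radical" unfolding path_radical_def by blast
  qed
qed

end

section \<open>Endomorphisms as path matrices\<close>

text \<open>Appending \<open>\<alpha>\<close> is injective on paths, so each coefficient of the
  image comes from at most one coefficient of \<open>x\<close>.\<close>

lemma lookup_append_arrow:
  fixes x :: "'a list \<Rightarrow>\<^sub>0 'k::field" and \<alpha> :: 'a
  defines "w \<equiv> \<Sum>p\<in>Poly_Mapping.keys x. Poly_Mapping.single (p @ [\<alpha>]) (Poly_Mapping.lookup x p)"
  shows "Poly_Mapping.lookup w [] = 0"
    and "Poly_Mapping.lookup w (r @ [\<beta>]) = (if \<beta> = \<alpha> then Poly_Mapping.lookup x r else 0)"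
proof -
  show "Poly_Mapping.lookup w [] = 0"
    by (simp add: w_def lookup_sum lookup_single when_def)
  have "Poly_Mapping.lookup w (r @ [\<beta>]) =
      (\<Sum>p\<in>Poly_Mapping.keys x. if r = p then (if \<beta> = \<alpha> then Poly_Mapping.lookup x r else 0) else 0)"
    unfolding w_def lookup_sum by (intro sum.cong) (auto simp: lookup_single when_def)
  then show "Poly_Mapping.lookup w (r @ [\<beta>]) = (if \<beta> = \<alpha> then Poly_Mapping.lookup x r else 0)"
    by (auto simp: in_keys_iff)
qed

lemma lookup_map_scale:
  "Poly_Mapping.lookup (Poly_Mapping.map ((*) c) x) p = (c :: 'k::field) * Poly_Mapping.lookup x p"
  by (simp add: Poly_Mapping.map.rep_eq when_def)

context acyclic_proj_sum
begin

section \<open>Coordinates in the sum of projectives\<close>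

abbreviation proj_space :: "'v \<Rightarrow> ('k::field, 'v \<times> nat \<Rightarrow> 'a list \<Rightarrow>\<^sub>0 'k) module" where
  "proj_space \<equiv> vspace (proj_sum Q d)"

abbreviation coords :: "('v \<times> nat \<Rightarrow> 'a list \<Rightarrow>\<^sub>0 'k::field) \<Rightarrow> 'v \<times> nat \<Rightarrow> 'a list \<Rightarrow> 'k" where
  "coords u \<equiv> \<lambda>z. Poly_Mapping.lookup (u z)"

text \<open>With finitely many summands the finite-support condition of the direct sum is
  automatic.\<close>

lemma proj_space_carrier:
  "u \<in> carrier (proj_space j) \<longleftrightarrow> u \<in> extensional summands \<and>
     (\<forall>z\<in>summands. \<forall>p. coords u z p \<noteq> 0 \<longrightarrow> awalk (fst z) p j)"
  by (fastforce simp: proj_sum_def direct_sum_rep_def proj_rep_def free_vspace_def PiE_def Pi_def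
      summands_def[symmetric] in_keys_iff split_beta)

lemma proj_space_ops:
  "u \<oplus>\<^bsub>proj_space j\<^esub> w = (\<lambda>z\<in>summands. u z + w z)"
  "c \<odot>\<^bsub>proj_space j\<^esub> u = (\<lambda>z\<in>summands. Poly_Mapping.map ((*) c) (u z))"
  "\<zero>\<^bsub>proj_space j\<^esub> = (\<lambda>z\<in>summands. 0)"
  by (auto simp: proj_sum_def direct_sum_rep_def proj_rep_def free_vspace_def
      summands_def[symmetric] split_beta restrict_def)

lemma coords_proj_space_ops [simp]:
  assumes "z \<in> summands"
  shows "coords (u \<oplus>\<^bsub>proj_space j\<^esub> w) z p = coords u z p + coords w z p"
    and "coords (c \<odot>\<^bsub>proj_space j\<^esub> u) z p = c * coords u z p"
    and "coords \<zero>\<^bsub>proj_space j\<^esub> z p = 0"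
    and "coords (arrow_map (proj_sum Q d) \<alpha> u) z [] = 0"
    and "coords (arrow_map (proj_sum Q d) \<alpha> u) z (p @ [\<beta>]) = (if \<beta> = \<alpha> then coords u z p else 0)"
  using assms by (simp_all only: proj_space_ops restrict_apply' lookup_add lookup_map_scale lookup_zero,
      simp_all add: proj_sum_def direct_sum_rep_def proj_rep_def summands_def[symmetric] split_beta
        lookup_append_arrow)

lemma proj_space_closed [simp]:
  assumes u: "u \<in> carrier (proj_space j)"
  shows "w \<in> carrier (proj_space j) \<Longrightarrow> u \<oplus>\<^bsub>proj_space j\<^esub> w \<in> carrier (proj_space j)"
    and "c \<odot>\<^bsub>proj_space j\<^esub> u \<in> carrier (proj_space j)"
    and "\<zero>\<^bsub>proj_space j\<^esub> \<in> carrier (proj_space j)"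
proof -
  have ext: "u \<oplus>\<^bsub>proj_space j\<^esub> w \<in> extensional summands" "c \<odot>\<^bsub>proj_space j\<^esub> u \<in> extensional summands"
    "\<zero>\<^bsub>proj_space j\<^esub> \<in> extensional summands" for w
    by (simp_all add: proj_space_ops)
  show "w \<in> carrier (proj_space j) \<Longrightarrow> u \<oplus>\<^bsub>proj_space j\<^esub> w \<in> carrier (proj_space j)"
    using u ext unfolding proj_space_carrier by (metis add_0 coords_proj_space_ops(1))
  show "c \<odot>\<^bsub>proj_space j\<^esub> u \<in> carrier (proj_space j)" "\<zero>\<^bsub>proj_space j\<^esub> \<in> carrier (proj_space j)"
    using u ext unfolding proj_space_carrier by simp_all
qed

lemma proj_space_arrow_closed:
  assumes u: "u \<in> carrier (proj_space (tail Q \<alpha>))" and \<alpha>: "\<alpha> \<in> arcs Q"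
  shows "arrow_map (proj_sum Q d) \<alpha> u \<in> carrier (proj_space (head Q \<alpha>))"
proof -
  have "awalk (fst z) p (head Q \<alpha>)"
    if z: "z \<in> summands" and nz: "coords (arrow_map (proj_sum Q d) \<alpha> u) z p \<noteq> 0" for z p
  proof (cases p rule: rev_cases)
    case Nil
    then show ?thesis using z nz by simp
  next
    case (snoc q \<beta>)
    then have "\<beta> = \<alpha>" "coords u z q \<noteq> 0"
      using z nz by (auto split: if_splits)
    then have "awalk (fst z) q (tail Q \<alpha>)" using u z by (simp add: proj_space_carrier)
    then show ?thesis using \<alpha> snoc \<open>\<beta> = \<alpha>\<close> by (auto simp: awalk_simps intro: arc_implies_awalk)
  qed
  moreover have "arrow_map (proj_sum Q d) \<alpha> u \<in> extensional summands"
    by (simp add: proj_sum_def direct_sum_rep_def summands_def[symmetric])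
  ultimately show ?thesis unfolding proj_space_carrier by blast
qed

lemma proj_space_eqI:
  assumes "u \<in> carrier (proj_space j)" "w \<in> carrier (proj_space j)"
    and "\<And>z p. z \<in> summands \<Longrightarrow> coords u z p = coords w z p"
  shows "u = w"
proof (rule extensionalityI[of _ summands])
  fix z assume "z \<in> summands"
  then show "u z = w z" using assms(3) by (intro poly_mapping_eqI) 
qed (use assms in \<open>auto simp: proj_space_carrier\<close>)

section \<open>The action of a path matrix on the sum of projectives\<close>

definition matrix_apply ::
  "('v, 'a, 'k::field) path_matrix \<Rightarrow> ('v \<times> nat \<Rightarrow> 'a list \<Rightarrow>\<^sub>0 'k) \<Rightarrow> 'v \<times> nat \<Rightarrow> 'a list \<Rightarrow>\<^sub>0 'k" where
  "matrix_apply f u = (\<lambda>z\<in>summands. Abs_poly_mapping (path_conv f (coords u) z))"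

text \<open>\<open>Abs_poly_mapping\<close> has the intended coefficients only on finite support: a
  path that occurs in the result is a walk from \<open>fst z\<close> to \<open>j\<close>, and there
  are finitely many of these.\<close>

lemma matrix_apply:
  assumes f: "f \<in> carrier path_matrices" and u: "u \<in> carrier (proj_space j)"
  shows "z \<in> summands \<Longrightarrow> coords (matrix_apply f u) z = path_conv f (coords u) z"
    and "matrix_apply f u \<in> carrier (proj_space j)"
proof -
  have walk: "awalk (fst z) r j" if nz: "path_conv f (coords u) z r \<noteq> 0" for z r
  proof -
    obtain y q p where y: "y \<in> summands" and r: "r = q @ p" and "f y z q \<noteq> 0" "coords u y p \<noteq> 0"
      using path_conv_nonzeroD[OF nz] by blast
    then have "awalk (fst z) q (fst y)" "awalk (fst y) p j"
      using f u by (auto simp: path_entry_def proj_space_carrier)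
    then show ?thesis using r by auto
  qed
  have "finite {r. path_conv f (coords u) z r \<noteq> 0}" for z
    using walk by (intro finite_subset[OF _ finite_awalks_between[of "fst z" j]]) blast
  then show coords: "coords (matrix_apply f u) z = path_conv f (coords u) z" if "z \<in> summands" for z
    using that by (simp add: matrix_apply_def)
  show "matrix_apply f u \<in> carrier (proj_space j)"
    unfolding proj_space_carrier using walk by (auto simp: coords) (simp add: matrix_apply_def)
qed

text \<open>A matrix prepends paths and an arrow appends a letter, so the two actions commute. The
  last letter of a product always belongs to the second factor, which is nonempty once an arrow has
  acted.\<close>

lemma path_conv_arrow:
  "path_conv f (coords (arrow_map (proj_sum Q d) \<alpha> u)) z [] = 0"
  "path_conv f (coords (arrow_map (proj_sum Q d) \<alpha> u)) z (r @ [\<beta>]) =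
    (if \<beta> = \<alpha> then path_conv f (coords u) z r else 0)"
proof -
  show "path_conv f (coords (arrow_map (proj_sum Q d) \<alpha> u)) z [] = 0"
    by (simp add: path_conv_def)
  have "path_conv f (coords (arrow_map (proj_sum Q d) \<alpha> u)) z (r @ [\<beta>]) =
      (\<Sum>y\<in>summands. \<Sum>(q, p)\<in>splits r. f y z q * (if \<beta> = \<alpha> then coords u y p else 0))"
    unfolding path_conv_def
    by (rule sum.cong[OF refl], subst sum_splits_snoc) simp_all
  then show "path_conv f (coords (arrow_map (proj_sum Q d) \<alpha> u)) z (r @ [\<beta>]) =
      (if \<beta> = \<alpha> then path_conv f (coords u) z r else 0)"
    by (simp add: path_conv_def)
qed

lemma matrix_apply_arrow:
  assumes f: "f \<in> carrier path_matrices" and \<alpha>: "\<alpha> \<in> arcs Q"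
    and u: "u \<in> carrier (proj_space (tail Q \<alpha>))"
  shows "matrix_apply f (arrow_map (proj_sum Q d) \<alpha> u) = arrow_map (proj_sum Q d) \<alpha> (matrix_apply f u)"
proof (rule proj_space_eqI)
  note au = proj_space_arrow_closed[OF u \<alpha>]
  show "matrix_apply f (arrow_map (proj_sum Q d) \<alpha> u) \<in> carrier (proj_space (head Q \<alpha>))"
    "arrow_map (proj_sum Q d) \<alpha> (matrix_apply f u) \<in> carrier (proj_space (head Q \<alpha>))"
    using matrix_apply(2)[OF f] proj_space_arrow_closed u \<alpha> by blast+
  fix z r assume z: "z \<in> summands"
  show "coords (matrix_apply f (arrow_map (proj_sum Q d) \<alpha> u)) z r =
      coords (arrow_map (proj_sum Q d) \<alpha> (matrix_apply f u)) z r"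
    by (cases r rule: rev_cases)
      (simp_all add: matrix_apply(1)[OF f au z] matrix_apply(1)[OF f u z] path_conv_arrow z)
qed

lemma matrix_apply_add:
  assumes f: "f \<in> carrier path_matrices"
    and u: "u \<in> carrier (proj_space j)" and w: "w \<in> carrier (proj_space j)"
  shows "matrix_apply f (u \<oplus>\<^bsub>proj_space j\<^esub> w) = matrix_apply f u \<oplus>\<^bsub>proj_space j\<^esub> matrix_apply f w"
proof (rule proj_space_eqI[of _ j])
  have "path_conv f (coords (u \<oplus>\<^bsub>proj_space j\<^esub> w)) = path_conv f (\<lambda>z p. coords u z p + coords w z p)"
    by (rule path_conv_cong) simp
  then show "coords (matrix_apply f (u \<oplus>\<^bsub>proj_space j\<^esub> w)) z p =
      coords (matrix_apply f u \<oplus>\<^bsub>proj_space j\<^esub> matrix_apply f w) z p" if "z \<in> summands" for z p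
    using that matrix_apply(1)[OF f u] matrix_apply(1)[OF f w]
      matrix_apply(1)[OF f proj_space_closed(1)[OF u w]]
    by (simp add: path_conv_add_right)
qed (use u w matrix_apply(2)[OF f] in \<open>blast intro: proj_space_closed\<close>)+

lemma matrix_apply_scale:
  assumes f: "f \<in> carrier path_matrices" and u: "u \<in> carrier (proj_space j)"
  shows "matrix_apply f (c \<odot>\<^bsub>proj_space j\<^esub> u) = c \<odot>\<^bsub>proj_space j\<^esub> matrix_apply f u"
proof (rule proj_space_eqI[of _ j])
  have "path_conv f (coords (c \<odot>\<^bsub>proj_space j\<^esub> u)) = path_conv f (\<lambda>z p. c * coords u z p)"
    by (rule path_conv_cong) simp
  then show "coords (matrix_apply f (c \<odot>\<^bsub>proj_space j\<^esub> u)) z p =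
      coords (c \<odot>\<^bsub>proj_space j\<^esub> matrix_apply f u) z p" if "z \<in> summands" for z p
    using that matrix_apply(1)[OF f u] matrix_apply(1)[OF f proj_space_closed(2)[OF u]]
    by (simp add: path_conv_scale_right)
qed (use u matrix_apply(2)[OF f] in \<open>blast intro: proj_space_closed\<close>)+

definition matrix_endo ::
  "('v, 'a, 'k::field) path_matrix
    \<Rightarrow> 'v \<Rightarrow> ('v \<times> nat \<Rightarrow> 'a list \<Rightarrow>\<^sub>0 'k) \<Rightarrow> ('v \<times> nat \<Rightarrow> 'a list \<Rightarrow>\<^sub>0 'k)" where
  "matrix_endo f = (\<lambda>j\<in>verts Q. \<lambda>u\<in>carrier (proj_space j). matrix_apply f u)"

lemma matrix_endo_closed:
  assumes f: "f \<in> carrier path_matrices"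
  shows "matrix_endo f \<in> rep_hom Q (proj_sum Q d) (proj_sum Q d)"
proof -
  have "restrict (matrix_apply f) (carrier (proj_space j)) \<in> linear_maps (proj_space j) (proj_space j)" for j
    unfolding linear_maps_def
    using matrix_apply(2)[OF f, of _ j] matrix_apply_add[OF f, of _ j] matrix_apply_scale[OF f, of _ j] by simp
  then show ?thesis
    unfolding rep_hom_def matrix_endo_def
    using matrix_apply_arrow[OF f] by (simp add: proj_space_arrow_closed)
qed

text \<open>For \<open>p = []\<close> this is the generator of the summand \<open>x\<close>; arrows
  produce the other basis vectors from it.\<close>

definition path_vector :: "'v \<times> nat \<Rightarrow> 'a list \<Rightarrow> 'v \<times> nat \<Rightarrow> 'a list \<Rightarrow>\<^sub>0 'k::field" where
  "path_vector x p = (\<lambda>z\<in>summands. if z = x then Poly_Mapping.single p 1 else 0)"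

lemma coords_path_vector:
  "z \<in> summands \<Longrightarrow> coords (path_vector x p) z q = (if z = x \<and> q = p then 1 else 0)"
  by (auto simp: path_vector_def lookup_single when_def)

lemma path_vector_closed:
  assumes "awalk (fst x) p j" shows "path_vector x p \<in> carrier (proj_space j)"
  unfolding proj_space_carrier using assms
  by (auto simp: coords_path_vector) (simp add: path_vector_def)

lemma path_vector_snoc:
  assumes "awalk (fst x) p (tail Q \<alpha>)" "\<alpha> \<in> arcs Q"
  shows "path_vector x (p @ [\<alpha>]) = arrow_map (proj_sum Q d) \<alpha> (path_vector x p)"
proof (rule proj_space_eqI)
  have "awalk (fst x) (p @ [\<alpha>]) (head Q \<alpha>)"
    using assms by (auto simp: awalk_simps intro: arc_implies_awalk)
  then show "path_vector x (p @ [\<alpha>]) \<in> carrier (proj_space (head Q \<alpha>))"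
    by (rule path_vector_closed)
  show "arrow_map (proj_sum Q d) \<alpha> (path_vector x p) \<in> carrier (proj_space (head Q \<alpha>))"
    using assms by (intro proj_space_arrow_closed path_vector_closed)
  fix z q assume "z \<in> summands"
  then show "coords (path_vector x (p @ [\<alpha>])) z q = coords (arrow_map (proj_sum Q d) \<alpha> (path_vector x p)) z q"
    by (cases q rule: rev_cases) (auto simp: coords_path_vector)
qed

lemma rep_homD:
  assumes "\<phi> \<in> rep_hom Q (proj_sum Q d) (proj_sum Q d)" "j \<in> verts Q"
  shows "\<phi> j \<in> carrier (proj_space j) \<rightarrow>\<^sub>E carrier (proj_space j)"
    and "u \<in> carrier (proj_space j) \<Longrightarrow> w \<in> carrier (proj_space j) \<Longrightarrow>
      \<phi> j (u \<oplus>\<^bsub>proj_space j\<^esub> w) = \<phi> j u \<oplus>\<^bsub>proj_space j\<^esub> \<phi> j w"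
    and "u \<in> carrier (proj_space j) \<Longrightarrow> \<phi> j (c \<odot>\<^bsub>proj_space j\<^esub> u) = c \<odot>\<^bsub>proj_space j\<^esub> \<phi> j u"
proof -
  have "\<phi> j \<in> linear_maps (proj_space j) (proj_space j)"
    using assms unfolding rep_hom_def by blast
  then show "\<phi> j \<in> carrier (proj_space j) \<rightarrow>\<^sub>E carrier (proj_space j)"
    "u \<in> carrier (proj_space j) \<Longrightarrow> w \<in> carrier (proj_space j) \<Longrightarrow>
      \<phi> j (u \<oplus>\<^bsub>proj_space j\<^esub> w) = \<phi> j u \<oplus>\<^bsub>proj_space j\<^esub> \<phi> j w"
    "u \<in> carrier (proj_space j) \<Longrightarrow> \<phi> j (c \<odot>\<^bsub>proj_space j\<^esub> u) = c \<odot>\<^bsub>proj_space j\<^esub> \<phi> j u"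
    unfolding linear_maps_def by blast+
qed

lemma rep_hom_arrow:
  assumes "\<phi> \<in> rep_hom Q (proj_sum Q d) (proj_sum Q d)" "\<alpha> \<in> arcs Q" "u \<in> carrier (proj_space (tail Q \<alpha>))"
  shows "\<phi> (head Q \<alpha>) (arrow_map (proj_sum Q d) \<alpha> u) = arrow_map (proj_sum Q d) \<alpha> (\<phi> (tail Q \<alpha>) u)"
  using assms unfolding rep_hom_def by blast

text \<open>Arrows carry agreement from the generators to all basis vectors, and linearity carries
  it to all vectors.\<close>

lemma rep_hom_eqI:
  fixes \<phi> \<psi> :: "'v \<Rightarrow> ('v \<times> nat \<Rightarrow> 'a list \<Rightarrow>\<^sub>0 'k::field) \<Rightarrow> 'v \<times> nat \<Rightarrow> 'a list \<Rightarrow>\<^sub>0 'k"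
  assumes \<phi>: "\<phi> \<in> rep_hom Q (proj_sum Q d) (proj_sum Q d)"
    and \<psi>: "\<psi> \<in> rep_hom Q (proj_sum Q d) (proj_sum Q d)"
    and gen: "\<And>x. x \<in> summands \<Longrightarrow> \<phi> (fst x) (path_vector x []) = \<psi> (fst x) (path_vector x [])"
  shows "\<phi> = \<psi>"
proof -
  have basis: "\<phi> j (path_vector x p) = \<psi> j (path_vector x p)"
    if "x \<in> summands" "awalk (fst x) p j" for x p j
    using that(2)
  proof (induction p arbitrary: j rule: rev_induct)
    case Nil
    then show ?case using gen[OF that(1)] unfolding awalk_Nil_iff by blast
  next
    case (snoc \<alpha> p)
    then have p: "awalk (fst x) p (tail Q \<alpha>)" and \<alpha>: "\<alpha> \<in> arcs Q" and j: "j = head Q \<alpha>"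
      by (auto simp: awalk_simps)
    then show ?case
      using rep_hom_arrow[OF \<phi> \<alpha> path_vector_closed[OF p]]
        rep_hom_arrow[OF \<psi> \<alpha> path_vector_closed[OF p]] snoc.IH[OF p]
      by (simp add: path_vector_snoc)
  qed
  \<comment> \<open>Induction on a finite set \<open>S\<close> containing the support: each step
    subtracts one basis vector, because additivity is given for two vectors at a time.\<close>
  have all: "\<phi> j u = \<psi> j u"
    if j: "j \<in> verts Q" and "finite S" "u \<in> carrier (proj_space j)"
      "{(y, p). y \<in> summands \<and> coords u y p \<noteq> 0} \<subseteq> S" for j S u
    using that(2-)
  proof (induction S arbitrary: u rule: finite_induct)
    case empty
    \<comment> \<open>Linearity is stated without the zero vector; writing \<open>u\<close> as
      \<open>0\<close> times itself makes both images zero.\<close>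
    have "u = 0 \<odot>\<^bsub>proj_space j\<^esub> u"
      using empty by (intro proj_space_eqI[of _ j] proj_space_closed) auto
    moreover have "0 \<odot>\<^bsub>proj_space j\<^esub> w = \<zero>\<^bsub>proj_space j\<^esub>"
      for w :: "'v \<times> nat \<Rightarrow> 'a list \<Rightarrow>\<^sub>0 'k"
      unfolding proj_space_ops by (intro restrict_ext poly_mapping_eqI) (simp add: lookup_map_scale)
    ultimately show ?case
      using rep_homD(3)[OF \<phi> j empty(1), of 0] rep_homD(3)[OF \<psi> j empty(1), of 0] by simp
  next
    case (insert b S)
    obtain y p where b: "b = (y, p)" by (rule prod.exhaust)
    show ?case
    proof (cases "y \<in> summands \<and> coords u y p \<noteq> 0")
      case False
      then have "{(y, p). y \<in> summands \<and> coords u y p \<noteq> 0} \<subseteq> S"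
        using insert.prems b by auto
      then show ?thesis using insert.IH insert.prems by blast
    next
      case True
      define c where "c = coords u y p"
      have walk: "awalk (fst y) p j"
        using True insert.prems(1) by (auto simp: proj_space_carrier)
      note pv = path_vector_closed[OF walk]
      define w where "w = u \<oplus>\<^bsub>proj_space j\<^esub> ((- c) \<odot>\<^bsub>proj_space j\<^esub> path_vector y p)"
      have w: "w \<in> carrier (proj_space j)"
        unfolding w_def by (intro proj_space_closed insert.prems(1) pv)
      have cw: "coords w z q = (if z = y \<and> q = p then 0 else coords u z q)" if "z \<in> summands" for z q
        using that by (simp add: w_def coords_path_vector c_def)
      have "\<phi> j w = \<psi> j w"
      proof (rule insert.IH[OF w])
        show "{(y, p). y \<in> summands \<and> coords w y p \<noteq> 0} \<subseteq> S"
        proof clarify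
          fix z q assume z: "z \<in> summands" "coords w z q \<noteq> 0"
          then have "(z, q) \<noteq> b" "coords u z q \<noteq> 0"
            by (auto simp: cw b split: if_splits)
          then show "(z, q) \<in> S" using z(1) insert.prems(2) by blast
        qed
      qed
      moreover have "u = w \<oplus>\<^bsub>proj_space j\<^esub> (c \<odot>\<^bsub>proj_space j\<^esub> path_vector y p)"
      proof (rule proj_space_eqI[of _ j])
        show "w \<oplus>\<^bsub>proj_space j\<^esub> (c \<odot>\<^bsub>proj_space j\<^esub> path_vector y p) \<in> carrier (proj_space j)"
          by (intro proj_space_closed w pv)
      qed (auto simp: cw coords_path_vector c_def insert.prems(1))
      moreover have "\<phi> j (path_vector y p) = \<psi> j (path_vector y p)"
        using basis True walk by blast
      ultimately show ?thesis
        using rep_homD(2,3)[OF \<phi> j] rep_homD(2,3)[OF \<psi> j] w pv by (metis proj_space_closed(2))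
    qed
  qed
  have "\<phi> j u = \<psi> j u" if "j \<in> verts Q" "u \<in> carrier (proj_space j)" for j u
  proof (rule all[OF that(1) _ that(2)])
    show "finite (SIGMA y:summands. Poly_Mapping.keys (u y))"
      by (intro finite_SigmaI finite_summands finite_keys)
    show "{(y, p). y \<in> summands \<and> coords u y p \<noteq> 0} \<subseteq> (SIGMA y:summands. Poly_Mapping.keys (u y))"
      by (auto simp: in_keys_iff)
  qed
  then have "\<phi> j = \<psi> j" if "j \<in> verts Q" for j
    using that by (intro PiE_ext[OF rep_homD(1)[OF \<phi> that] rep_homD(1)[OF \<psi> that]])
  then show ?thesis
  proof (rule PiE_ext[rotated 2])
    show "\<phi> \<in> (\<Pi>\<^sub>E j\<in>verts Q. linear_maps (proj_space j) (proj_space j))"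
      "\<psi> \<in> (\<Pi>\<^sub>E j\<in>verts Q. linear_maps (proj_space j) (proj_space j))"
      using \<phi> \<psi> unfolding rep_hom_def by blast+
  qed
qed

text \<open>The generator of \<open>x\<close> has a unit column as coordinates, so the matrix
  returns its own column \<open>x\<close>: the endomorphism determines the matrix.\<close>

lemma matrix_endo_generator:
  assumes f: "f \<in> carrier path_matrices" and x: "x \<in> summands" and z: "z \<in> summands"
  shows "coords (matrix_endo f (fst x) (path_vector x [])) z p = f x z p"
proof -
  have xv: "fst x \<in> verts Q" using x by (auto simp: summands_def)
  then have pv: "path_vector x [] \<in> carrier (proj_space (fst x))"
    by (intro path_vector_closed) (simp add: awalk_Nil_iff)
  have "coords (matrix_endo f (fst x) (path_vector x [])) z = path_conv f (coords (path_vector x [])) z"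
    unfolding matrix_endo_def restrict_apply'[OF xv] restrict_apply'[OF pv] by (rule matrix_apply(1)[OF f pv z])
  also have "path_conv f (coords (path_vector x [])) = path_conv f (unit_column x)"
    using x by (intro path_conv_cong) (auto simp: coords_path_vector unit_column_def)
  finally show ?thesis using x by (simp add: path_conv_unit_right)
qed

text \<open>The bijection between homomorphisms out of \<open>P(i)\<close> and vectors at
  \<open>i\<close>, for all summands at once: a column is the image of a generator, and its paths
  end at \<open>fst x\<close> because that image lies in the space at \<open>fst x\<close>.\<close>

lemma matrix_endo_bij:
  "bij_betw matrix_endo (carrier path_matrices)
     (rep_hom Q (proj_sum Q d) (proj_sum Q d :: ('v, 'a, 'k::field, _) quiver_rep))"
  unfolding bij_betw_def
proof
  show "inj_on matrix_endo (carrier path_matrices :: ('v, 'a, 'k) path_matrix set)"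
  proof (rule inj_onI, intro ext)
    fix f g :: "('v, 'a, 'k) path_matrix" and x z p
    assume f: "f \<in> carrier path_matrices" and g: "g \<in> carrier path_matrices"
      and eq: "matrix_endo f = matrix_endo g"
    show "f x z p = g x z p"
    proof (cases "x \<in> summands \<and> z \<in> summands")
      case True
      then show ?thesis
        using matrix_endo_generator[OF f] matrix_endo_generator[OF g] eq by metis
    next
      case False
      then have "\<not> path_entry x z p" by (auto simp: path_entry_def)
      then show ?thesis using f g unfolding path_matrices_simps by metis
    qed
  qed
  show "matrix_endo ` carrier path_matrices = rep_hom Q (proj_sum Q d) (proj_sum Q d :: ('v, 'a, 'k, _) quiver_rep)"
  proof
    show "matrix_endo ` carrier path_matrices \<subseteq> rep_hom Q (proj_sum Q d) (proj_sum Q d :: ('v, 'a, 'k, _) quiver_rep)"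
      using matrix_endo_closed by blast
    show "rep_hom Q (proj_sum Q d) (proj_sum Q d :: ('v, 'a, 'k, _) quiver_rep) \<subseteq> matrix_endo ` carrier path_matrices"
    proof
      fix \<phi> :: "'v \<Rightarrow> ('v \<times> nat \<Rightarrow> 'a list \<Rightarrow>\<^sub>0 'k) \<Rightarrow> 'v \<times> nat \<Rightarrow> 'a list \<Rightarrow>\<^sub>0 'k"
      assume \<phi>: "\<phi> \<in> rep_hom Q (proj_sum Q d) (proj_sum Q d)"
      define f where "f = (\<lambda>x z p. if x \<in> summands \<and> z \<in> summands
        then coords (\<phi> (fst x) (path_vector x [])) z p else 0)"
      have gen: "path_vector x [] \<in> carrier (proj_space (fst x))" "fst x \<in> verts Q"
        if "x \<in> summands" for x
        using that by (auto simp: summands_def awalk_Nil_iff intro!: path_vector_closed)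
      have \<phi>_gen: "\<phi> (fst x) (path_vector x []) \<in> carrier (proj_space (fst x))" if "x \<in> summands" for x
        using rep_homD(1)[OF \<phi> gen(2)[OF that]] gen(1)[OF that] by blast
      have f: "f \<in> carrier path_matrices"
        using \<phi>_gen by (auto simp: f_def path_entry_def proj_space_carrier split: if_splits)
      have "matrix_endo f = \<phi>"
      proof (rule rep_hom_eqI[OF matrix_endo_closed[OF f] \<phi>])
        fix x assume x: "x \<in> summands"
        have "matrix_endo f (fst x) (path_vector x []) \<in> carrier (proj_space (fst x))"
          using rep_homD(1)[OF matrix_endo_closed[OF f] gen(2)[OF x]] gen(1)[OF x] by blast
        then show "matrix_endo f (fst x) (path_vector x []) = \<phi> (fst x) (path_vector x [])"
          using \<phi>_gen[OF x] matrix_endo_generator[OF f x] x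
          by (intro proj_space_eqI[of _ "fst x"]) (simp_all add: f_def)
      qed
      then show "\<phi> \<in> matrix_endo ` carrier path_matrices" using f by blast
    qed
  qed
qed

section \<open>Compatibility with the algebra operations\<close>

lemma matrix_apply_eqI:
  assumes f: "f \<in> carrier path_matrices" and u: "u \<in> carrier (proj_space j)" and w: "w \<in> carrier (proj_space j)"
    and "\<And>z p. z \<in> summands \<Longrightarrow> path_conv f (coords u) z p = coords w z p"
  shows "matrix_apply f u = w"
  using matrix_apply[OF f u] assms(4) by (intro proj_space_eqI[OF _ w]) auto

lemma matrix_apply_mult:
  assumes f: "f \<in> carrier path_matrices" and g: "g \<in> carrier path_matrices" and u: "u \<in> carrier (proj_space j)"
  shows "matrix_apply (\<lambda>x. path_conv f (g x)) u = matrix_apply f (matrix_apply g u)"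
proof (rule matrix_apply_eqI[OF path_matrices_mult_closed[OF f g] u])
  note gu = matrix_apply[OF g u]
  show "matrix_apply f (matrix_apply g u) \<in> carrier (proj_space j)"
    using matrix_apply(2)[OF f] gu(2) by blast
  have "path_conv f (coords (matrix_apply g u)) = path_conv f (path_conv g (coords u))"
    using gu(1) by (intro path_conv_cong) simp
  then show "path_conv (\<lambda>x. path_conv f (g x)) (coords u) z p = coords (matrix_apply f (matrix_apply g u)) z p"
    if "z \<in> summands" for z p
    using matrix_apply(1)[OF f gu(2) that] by (simp add: path_conv_assoc)
qed

lemma path_matrices_add_closed:
  "f \<in> carrier path_matrices \<Longrightarrow> g \<in> carrier path_matrices \<Longrightarrow> f + g \<in> carrier path_matrices"
  using path_filtration_add[of f 0 g] by (simp only: path_filtration_0)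

lemma matrix_apply_matrix_add:
  assumes f: "f \<in> carrier path_matrices" and g: "g \<in> carrier path_matrices" and u: "u \<in> carrier (proj_space j)"
  shows "matrix_apply (f + g) u = matrix_apply f u \<oplus>\<^bsub>proj_space j\<^esub> matrix_apply g u"
proof (rule matrix_apply_eqI[OF path_matrices_add_closed[OF f g] u])
  show "matrix_apply f u \<oplus>\<^bsub>proj_space j\<^esub> matrix_apply g u \<in> carrier (proj_space j)"
    by (intro proj_space_closed matrix_apply(2)[OF f u] matrix_apply(2)[OF g u])
  show "path_conv (f + g) (coords u) z p = coords (matrix_apply f u \<oplus>\<^bsub>proj_space j\<^esub> matrix_apply g u) z p"
    if "z \<in> summands" for z p
    using that path_conv_add_left[of f g "coords u"]
    by (simp add: plus_fun_def matrix_apply(1)[OF f u that] matrix_apply(1)[OF g u that])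
qed

lemma matrix_apply_matrix_scale:
  assumes f: "f \<in> carrier path_matrices" and u: "u \<in> carrier (proj_space j)"
  shows "matrix_apply (\<lambda>x z p. c * f x z p) u = c \<odot>\<^bsub>proj_space j\<^esub> matrix_apply f u"
proof (rule matrix_apply_eqI[OF _ u])
  show "(\<lambda>x z p. c * f x z p) \<in> carrier path_matrices" using f by simp
  show "c \<odot>\<^bsub>proj_space j\<^esub> matrix_apply f u \<in> carrier (proj_space j)"
    by (intro proj_space_closed matrix_apply(2)[OF f u])
  show "path_conv (\<lambda>x z p. c * f x z p) (coords u) z p = coords (c \<odot>\<^bsub>proj_space j\<^esub> matrix_apply f u) z p"
    if "z \<in> summands" for z p
    using that by (simp add: path_conv_scale_left matrix_apply(1)[OF f u that])
qed

lemma matrix_apply_one: "u \<in> carrier (proj_space j) \<Longrightarrow> matrix_apply unit_column u = u"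
  by (rule matrix_apply_eqI[OF path_matrices_one_closed]) (simp_all add: path_conv_unit_left)

lemma matrix_apply_zero:
  assumes u: "u \<in> carrier (proj_space j)" shows "matrix_apply 0 u = \<zero>\<^bsub>proj_space j\<^esub>"
proof (rule matrix_apply_eqI[OF _ u proj_space_closed(3)[OF u]])
  show "path_conv 0 (coords u) z p = coords \<zero>\<^bsub>proj_space j\<^esub> z p" if "z \<in> summands" for z p
    using that by (simp add: path_conv_def split_beta)
qed simp

lemma proj_End_carrier: "carrier (proj_End K Q d) = rep_hom Q (proj_sum Q d) (proj_sum Q d)"
  by (simp add: proj_End_def rep_End_def)

lemma matrix_endo_mult:
  assumes f: "f \<in> carrier path_matrices" and g: "g \<in> carrier path_matrices"
  shows "matrix_endo (f \<otimes>\<^bsub>path_matrices\<^esub> g) = matrix_endo f \<otimes>\<^bsub>proj_End K Q d\<^esub> matrix_endo g"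
proof -
  have "matrix_endo f \<otimes>\<^bsub>proj_End K Q d\<^esub> matrix_endo g =
      (\<lambda>j\<in>verts Q. compose (carrier (proj_space j)) (matrix_endo f j) (matrix_endo g j))"
    by (simp add: proj_End_def rep_End_def)
  also have "\<dots> = matrix_endo (f \<otimes>\<^bsub>path_matrices\<^esub> g)"
    unfolding matrix_endo_def compose_def path_matrices_simps
    by (intro restrict_ext) (simp add: matrix_apply(2)[OF g] matrix_apply_mult[OF f g])
  finally show ?thesis by (rule sym)
qed

lemma matrix_endo_add:
  assumes f: "f \<in> carrier path_matrices" and g: "g \<in> carrier path_matrices"
  shows "matrix_endo (f \<oplus>\<^bsub>path_matrices\<^esub> g) = matrix_endo f \<oplus>\<^bsub>proj_End K Q d\<^esub> matrix_endo g"
proof -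
  have "matrix_endo f \<oplus>\<^bsub>proj_End K Q d\<^esub> matrix_endo g =
      (\<lambda>j\<in>verts Q. \<lambda>u\<in>carrier (proj_space j). matrix_endo f j u \<oplus>\<^bsub>proj_space j\<^esub> matrix_endo g j u)"
    by (simp add: proj_End_def rep_End_def)
  also have "\<dots> = matrix_endo (f \<oplus>\<^bsub>path_matrices\<^esub> g)"
    unfolding matrix_endo_def path_matrices_simps
    by (intro restrict_ext) (simp add: matrix_apply_matrix_add[OF f g])
  finally show ?thesis by (rule sym)
qed

lemma matrix_endo_scale:
  assumes f: "f \<in> carrier path_matrices"
  shows "matrix_endo (c \<odot>\<^bsub>path_matrices\<^esub> f) = c \<odot>\<^bsub>proj_End K Q d\<^esub> matrix_endo f"
proof -
  have "c \<odot>\<^bsub>proj_End K Q d\<^esub> matrix_endo f =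
      (\<lambda>j\<in>verts Q. \<lambda>u\<in>carrier (proj_space j). c \<odot>\<^bsub>proj_space j\<^esub> matrix_endo f j u)"
    by (simp add: proj_End_def rep_End_def)
  also have "\<dots> = matrix_endo (c \<odot>\<^bsub>path_matrices\<^esub> f)"
    unfolding matrix_endo_def path_matrices_simps
    by (intro restrict_ext) (simp add: matrix_apply_matrix_scale[OF f])
  finally show ?thesis by (rule sym)
qed

lemma matrix_endo_one: "matrix_endo \<one>\<^bsub>path_matrices\<^esub> = \<one>\<^bsub>proj_End K Q d\<^esub>"
proof -
  have "\<one>\<^bsub>proj_End K Q d\<^esub> = (\<lambda>j\<in>verts Q. \<lambda>u\<in>carrier (proj_space j). u)"
    by (simp add: proj_End_def rep_End_def)
  also have "\<dots> = matrix_endo \<one>\<^bsub>path_matrices\<^esub>"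
    unfolding matrix_endo_def path_matrices_simps
    by (intro restrict_ext) (simp add: matrix_apply_one)
  finally show ?thesis by (rule sym)
qed

lemma matrix_endo_zero: "matrix_endo \<zero>\<^bsub>path_matrices\<^esub> = \<zero>\<^bsub>proj_End K Q d\<^esub>"
proof -
  have "\<zero>\<^bsub>proj_End K Q d\<^esub> = (\<lambda>j\<in>verts Q. \<lambda>u\<in>carrier (proj_space j). \<zero>\<^bsub>proj_space j\<^esub>)"
    by (simp add: proj_End_def rep_End_def)
  also have "\<dots> = matrix_endo \<zero>\<^bsub>path_matrices\<^esub>"
    unfolding matrix_endo_def path_matrices_simps
    by (intro restrict_ext) (simp add: matrix_apply_zero)
  finally show ?thesis by (rule sym)
qed

lemma matrix_endo_ring_iso: "matrix_endo \<in> ring_iso path_matrices (proj_End K Q d)"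
  unfolding ring_iso_def ring_hom_def mem_Collect_eq proj_End_carrier
  by (intro conjI allI impI funcsetI matrix_endo_bij matrix_endo_closed matrix_endo_mult
      matrix_endo_add matrix_endo_one; blast)

lemma ring_proj_End: "ring (proj_End K Q d)"
proof -
  \<comment> \<open>Transport of structure gives a ring whose zero is the image of the zero matrix;
    this is the zero already present, so the record update changes nothing.\<close>
  have "ring ((proj_End K Q d)\<lparr>zero := matrix_endo \<zero>\<^bsub>path_matrices\<^esub>\<rparr>)"
    using ring.ring_iso_imp_img_ring[OF ring_path_matrices matrix_endo_ring_iso] .
  then show ?thesis using matrix_endo_zero[of K] by simp
qed

lemma jacobson_radical_proj_End:
  "jacobson_radical (proj_End K Q d) = matrix_endo ` path_radical"
  using jacobson_radical_image[OF ring_path_matrices ring_proj_End matrix_endo_ring_iso]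
  unfolding jacobson_radical_path_matrices by (rule sym)

lemma path_matrices_radical_isomorphic:
  "ideals_isomorphic (path_radical) path_matrices (jacobson_radical (proj_End K Q d)) (proj_End K Q d)"
proof -
  have sub: "path_radical \<subseteq> carrier path_matrices" unfolding path_radical_def by blast
  then have "bij_betw matrix_endo (path_radical) (jacobson_radical (proj_End K Q d))"
    unfolding jacobson_radical_proj_End using bij_betw_subset[OF matrix_endo_bij] by blast
  then show ?thesis
    unfolding ideals_isomorphic_def
    by (intro exI[of _ matrix_endo] conjI allI ballI matrix_endo_mult matrix_endo_add
        matrix_endo_scale subsetD[OF sub])
qed

end

section \<open>Splitting the arrows into a sink\<close>

lemma splits_map: "splits (map h r) = (\<lambda>(q, p). (map h q, map h p)) ` splits r"
  by (auto simp: splits_def image_iff append_eq_map_conv map_eq_append_conv)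

text \<open>A cut is determined by its position, and \<open>map h\<close> keeps positions even where
  \<open>h\<close> identifies letters, as \<open>underlying\<close> does with the duplicates of an
  arrow.\<close>

lemma sum_splits_map:
  "(\<Sum>(q, p)\<in>splits (map h r). F q p) = (\<Sum>(q, p)\<in>splits r. F (map h q) (map h p))"
proof -
  have "inj_on (\<lambda>(q, p). (map h q, map h p)) (splits r)"
    by (auto simp: inj_on_def splits_def) (metis append_eq_append_conv length_map)+
  then show ?thesis by (simp add: splits_map sum.reindex case_prod_unfold o_def)
qed

locale sink_splitting = acyclic_proj_sum Q d
  for Q :: "('v, 'a) pre_digraph" and d :: "'v \<Rightarrow> nat" +
  fixes v :: 'v
  assumes v: "v \<in> verts Q" and sink: "out_arcs Q v = {}"
begin

section \<open>The quiver with duplicated arrows\<close>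

definition dup_quiver :: "('v, 'a + 'a \<times> nat) pre_digraph" where
  "dup_quiver = duplicate_arrows Q v (d v)"

definition dup_mult :: "'v \<Rightarrow> nat" where
  "dup_mult = d(v := 1)"

definition underlying :: "'a + 'a \<times> nat \<Rightarrow> 'a" where
  "underlying = case_sum id fst"

lemma underlying_simps [simp]: "underlying (Inl a) = a" "underlying (Inr b) = fst b"
  by (simp_all add: underlying_def)

lemma dup_simps:
  "verts dup_quiver = verts Q"
  "tail dup_quiver b = tail Q (underlying b)"
  "head dup_quiver b = head Q (underlying b)"
  "Inl a \<in> arcs dup_quiver \<longleftrightarrow> a \<in> arcs Q \<and> head Q a \<noteq> v"
  "Inr (a, k) \<in> arcs dup_quiver \<longleftrightarrow> a \<in> arcs Q \<and> head Q a = v \<and> k \<in> {1..d v}"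
  by (auto simp: dup_quiver_def duplicate_arrows_def split: sum.split)

lemma underlying_arc: "b \<in> arcs dup_quiver \<Longrightarrow> underlying b \<in> arcs Q"
  by (cases b) (auto simp: dup_simps)

lemma fin_digraph_dup: "fin_digraph dup_quiver"
proof
  fix e assume "e \<in> arcs dup_quiver"
  then show "tail dup_quiver e \<in> verts dup_quiver" "head dup_quiver e \<in> verts dup_quiver"
    using underlying_arc by (simp_all add: dup_simps)
qed (simp_all add: dup_quiver_def duplicate_arrows_def in_arcs_def)

lemma cas_dup: "pre_digraph.cas dup_quiver u p w \<longleftrightarrow> cas u (map underlying p) w"
  by (induction p arbitrary: u) (simp_all add: pre_digraph.cas.simps dup_simps)

lemma awalk_dup:
  "pre_digraph.awalk dup_quiver u p w \<longleftrightarrow> set p \<subseteq> arcs dup_quiver \<and> awalk u (map underlying p) w"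
  using underlying_arc by (auto simp: pre_digraph.awalk_def cas_dup dup_simps)

text \<open>Forgetting copy numbers would turn a cycle into a nonempty closed walk of
  \<open>Q\<close>.\<close>

lemma acyclic_dup: "acyclic_quiver dup_quiver"
  unfolding acyclic_quiver_def pre_digraph.cycle_def awalk_dup
  using closed_awalk_Nil by blast

sublocale dup: acyclic_proj_sum dup_quiver dup_mult
  using fin_digraph_dup acyclic_dup by (intro acyclic_proj_sum.intro acyclic_proj_sum_axioms.intro)

lemma awalk_from_sink: "awalk v p w \<Longrightarrow> p = []"
  using sink by (cases p) (auto simp: awalk_Cons_iff out_arcs_def)

text \<open>A walk that enters \<open>v\<close> stops there, so a walk ending elsewhere uses only
  arrows that are not duplicated.\<close>

lemma awalk_heads_not_sink:
  assumes "awalk u p w" "w \<noteq> v" "a \<in> set p"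
  shows "head Q a \<noteq> v"
proof
  assume a: "head Q a = v"
  obtain p1 p2 where "p = p1 @ a # p2" using assms(3) by (meson split_list)
  then have "awalk v p2 w" using assms(1) a by (auto simp: awalk_Cons_iff)
  then have "p2 = []" by (rule awalk_from_sink)
  then show False using \<open>awalk v p2 w\<close> assms(2) by (simp add: awalk_Nil_iff)
qed

lemma awalk_snoc_iff:
  "awalk u (p @ [a]) w \<longleftrightarrow> awalk u p (tail Q a) \<and> a \<in> arcs Q \<and> head Q a = w"
  by (auto simp: awalk_simps)

lemma arc_tail_not_sink: "a \<in> arcs Q \<Longrightarrow> tail Q a \<noteq> v"
  using sink by (auto simp: out_arcs_def)

text \<open>
  The copy number \<open>k\<close> of the last arrow \<open>\<alpha>\<^sup>k\<close> of a path into \<open>v\<close> encodes the summand \<open>(v, k - 1)\<close>;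
  paths avoiding \<open>v\<close> are unchanged.
\<close>

definition column :: "'v \<times> nat \<Rightarrow> ('a + 'a \<times> nat) list \<Rightarrow> 'v \<times> nat" where
  "column x p = (if fst x = v then (v, case_sum (\<lambda>_. 0) snd (last p) - 1) else x)"

definition merged :: "'v \<times> nat \<Rightarrow> 'v \<times> nat" where
  "merged x = (if fst x = v then (v, 0) else x)"

text \<open>Only the last arrow of a walk can enter \<open>v\<close>, so all others take the form
  \<open>Inl\<close>. \<open>Suc\<close> reconciles copies counted from \<open>1\<close> with
  summands counted from \<open>0\<close>.\<close>

definition lift_path :: "'v \<times> nat \<Rightarrow> 'a list \<Rightarrow> ('a + 'a \<times> nat) list" where
  "lift_path x p = (if fst x = v then map Inl (butlast p) @ [Inr (last p, Suc (snd x))] else map Inl p)"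

lemma summands_dup: "x \<in> dup.summands \<longleftrightarrow> (if fst x = v then x = (v, 0) else x \<in> summands)"
  unfolding dup.summands_def summands_def dup_simps unfolding dup_mult_def using v by (cases x) auto

lemma entry_source_not_sink: "path_entry x z p \<Longrightarrow> p \<noteq> [] \<Longrightarrow> fst z \<noteq> v"
  using awalk_from_sink by (auto simp: path_entry_def)

lemma dup_entry_iff:
  "dup.path_entry x z p \<longleftrightarrow> x \<in> dup.summands \<and> z \<in> dup.summands \<and> set p \<subseteq> arcs dup_quiver \<and>
     awalk (fst z) (map underlying p) (fst x)"
  by (auto simp: dup.path_entry_def awalk_dup)

lemma dup_entry_source_not_sink:
  assumes "dup.path_entry x z p" "p \<noteq> []" shows "fst z \<noteq> v"
proof -
  have "awalk (fst z) (map underlying p) (fst x)" using assms by (simp add: dup_entry_iff)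
  then show ?thesis using awalk_from_sink[of "map underlying p" "fst x"] assms(2) by auto
qed

text \<open>Together with \<open>lower_entry\<close> this is a bijection between the nonconstant
  entries of both kinds of matrices that fixes the row \<open>z\<close>. The copy number
  \<open>Suc (snd x)\<close> exists because \<open>snd x < d v\<close>.\<close>

lemma lift_entry:
  assumes e: "path_entry x z p" and p: "p \<noteq> []"
  shows "dup.path_entry (merged x) z (lift_path x p)"
    and "column (merged x) (lift_path x p) = x"
    and "map underlying (lift_path x p) = p"
    and "lift_path x p \<noteq> []"
proof -
  have x: "x \<in> summands" and z: "z \<in> summands" and walk: "awalk (fst z) p (fst x)"
    using e by (auto simp: path_entry_def)
  have zv: "fst z \<noteq> v" using entry_source_not_sink[OF e p] .
  show map: "map underlying (lift_path x p) = p"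
    using p by (simp add: lift_path_def o_def)
  show "lift_path x p \<noteq> []" using p by (simp add: lift_path_def)
  show "column (merged x) (lift_path x p) = x"
    by (cases x) (auto simp: column_def merged_def lift_path_def)
  have "set (lift_path x p) \<subseteq> arcs dup_quiver"
  proof (cases "fst x = v")
    case True
    \<comment> \<open>The last arrow starts away from \<open>v\<close>, so the walk before it avoids
      \<open>v\<close> and its arrows survive as \<open>Inl\<close>.\<close>
    obtain p0 a where p0: "p = p0 @ [a]" using p by (metis append_butlast_last_id)
    then have w0: "awalk (fst z) p0 (tail Q a)" and a: "a \<in> arcs Q" "head Q a = v"
      using walk True by (auto simp: awalk_snoc_iff)
    have "head Q b \<noteq> v" "b \<in> arcs Q" if "b \<in> set p0" for b
      using awalk_heads_not_sink[OF w0 arc_tail_not_sink that] a w0 that by blast+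
    moreover have "snd x < d v" using x True by (auto simp: summands_def)
    ultimately show ?thesis using True p0 a by (simp add: lift_path_def dup_simps image_subset_iff)
  next
    case False
    then show ?thesis
      using walk awalk_heads_not_sink[OF walk] by (auto 0 3 simp: lift_path_def dup_simps)
  qed
  moreover have "fst (merged x) = fst x" by (simp add: merged_def)
  moreover have "merged x \<in> dup.summands" "z \<in> dup.summands"
    using x z zv by (auto simp: summands_dup merged_def)
  ultimately show "dup.path_entry (merged x) z (lift_path x p)"
    using walk map by (simp add: dup_entry_iff)
qed

text \<open>The copy \<open>k \<in> {1..d v}\<close> of a last arrow into \<open>v\<close> names the
  summand \<open>k - 1 < d v\<close>; no other arrow of the path carries a copy number, so nothing
  else is forgotten.\<close>

lemma lower_entry:
  assumes e: "dup.path_entry x z p" and p: "p \<noteq> []"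
  shows "path_entry (column x p) z (map underlying p)"
    and "merged (column x p) = x"
    and "lift_path (column x p) (map underlying p) = p"
proof -
  have x: "x \<in> dup.summands" and z: "z \<in> dup.summands" and arcs: "set p \<subseteq> arcs dup_quiver"
    and walk: "awalk (fst z) (map underlying p) (fst x)"
    using e by (auto simp: dup_entry_iff)
  have zv: "fst z \<noteq> v" using dup_entry_source_not_sink[OF e p] .
  have inl: "b = Inl (underlying b)" if "b \<in> arcs dup_quiver" "head Q (underlying b) \<noteq> v" for b
    using that by (cases b) (auto simp: dup_simps)
  have *: "column x p \<in> summands \<and> merged (column x p) = x \<and> lift_path (column x p) (map underlying p) = p"
  proof (cases "fst x = v")
    case True
    then have x0: "x = (v, 0)" using x by (simp add: summands_dup)
    obtain p0 b where p0: "p = p0 @ [b]" using p by (metis append_butlast_last_id)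
    then have w0: "awalk (fst z) (map underlying p0) (tail Q (underlying b))"
      and b: "underlying b \<in> arcs Q" "head Q (underlying b) = v"
      using walk True by (auto simp: awalk_snoc_iff)
    have b_arc: "b \<in> arcs dup_quiver" using arcs p0 by simp
    \<comment> \<open>Arrows into \<open>v\<close> exist only as duplicates, so the default value
      for \<open>Inl\<close> in \<open>column\<close> does not arise.\<close>
    obtain ak where "b = Inr ak" using b b_arc by (cases b) (simp_all add: dup_simps)
    then obtain a k where bk: "b = Inr (a, k)" by (metis surj_pair)
    then have k: "k \<in> {1..d v}" using b_arc by (simp add: dup_simps)
    have "map (Inl \<circ> underlying) p0 = p0"
    proof (rule map_idI)
      fix c assume c: "c \<in> set p0"
      then have "head Q (underlying c) \<noteq> v"
        using awalk_heads_not_sink[OF w0 arc_tail_not_sink[OF b(1)]] by simp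
      then show "(Inl \<circ> underlying) c = c" using inl[of c] c arcs p0 by auto
    qed
    then show ?thesis
      using bk k v p0 True x0 by (auto simp: column_def merged_def lift_path_def summands_def)
  next
    case False
    have "map (Inl \<circ> underlying) p = p"
    proof (rule map_idI)
      fix c assume c: "c \<in> set p"
      then have "head Q (underlying c) \<noteq> v"
        using awalk_heads_not_sink[OF walk False] by simp
      then show "(Inl \<circ> underlying) c = c" using inl[of c] c arcs by auto
    qed
    then show ?thesis
      using False x by (simp add: column_def merged_def lift_path_def summands_dup)
  qed
  then show "merged (column x p) = x" "lift_path (column x p) (map underlying p) = p" by blast+
  have "fst (column x p) = fst x" by (simp add: column_def)
  then show "path_entry (column x p) z (map underlying p)"
    using * walk z zv by (simp add: path_entry_def summands_dup)
qed

section \<open>Transport of radical matrices\<close>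

definition split_matrix ::
  "('v, 'a, 'k::field) path_matrix \<Rightarrow> ('v, 'a + 'a \<times> nat, 'k) path_matrix" where
  "split_matrix f = (\<lambda>x z p. if dup.path_entry x z p \<and> p \<noteq> [] then f (column x p) z (map underlying p) else 0)"

definition merge_matrix ::
  "('v, 'a + 'a \<times> nat, 'k::field) path_matrix \<Rightarrow> ('v, 'a, 'k) path_matrix" where
  "merge_matrix g = (\<lambda>x z p. if path_entry x z p \<and> p \<noteq> [] then g (merged x) z (lift_path x p) else 0)"

lemma radical_entryD:
  "f \<in> path_radical \<Longrightarrow> f x z p \<noteq> 0 \<Longrightarrow> path_entry x z p \<and> p \<noteq> []"
  unfolding path_radical_def mem_Collect_eq path_matrices_simps by metis

lemma dup_radical_entryD:
  "f \<in> dup.path_radical \<Longrightarrow> f x z p \<noteq> 0 \<Longrightarrow> dup.path_entry x z p \<and> p \<noteq> []"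
  unfolding dup.path_radical_def mem_Collect_eq dup.path_matrices_simps by metis

lemma split_matrix_closed: "split_matrix f \<in> dup.path_radical"
  unfolding dup.path_radical_def by (simp add: split_matrix_def)

lemma merge_matrix_closed: "merge_matrix g \<in> path_radical"
  unfolding path_radical_def by (simp add: merge_matrix_def)

lemma merge_split_matrix:
  assumes "f \<in> path_radical" shows "merge_matrix (split_matrix f) = f"
proof (intro ext)
  fix x z p
  show "merge_matrix (split_matrix f) x z p = f x z p"
  proof (cases "path_entry x z p \<and> p \<noteq> []")
    case True
    then show ?thesis using lift_entry[of x z p] by (simp add: merge_matrix_def split_matrix_def)
  next
    case False
    then show ?thesis using radical_entryD[OF assms, of x z p] by (auto simp: merge_matrix_def)
  qed
qed

lemma split_merge_matrix:
  assumes "g \<in> dup.path_radical" shows "split_matrix (merge_matrix g) = g"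
proof (intro ext)
  fix x z p
  show "split_matrix (merge_matrix g) x z p = g x z p"
  proof (cases "dup.path_entry x z p \<and> p \<noteq> []")
    case True
    then show ?thesis using lower_entry[of x z p] by (simp add: merge_matrix_def split_matrix_def)
  next
    case False
    then show ?thesis using dup_radical_entryD[OF assms, of x z p] by (auto simp: split_matrix_def)
  qed
qed

lemma split_matrix_bij:
  "bij_betw split_matrix (path_radical) (dup.path_radical :: ('v, _, 'k::field) path_matrix set)"
  by (rule bij_betw_byWitness[where f' = merge_matrix])
    (use merge_split_matrix split_merge_matrix split_matrix_closed merge_matrix_closed in blast)+

text \<open>A middle summand at \<open>v\<close> contributes nothing on either side, because the
  path of the second factor would be nonconstant and start at the sink. For the other middle
  summands the last arrow of \<open>r\<close> belongs to the second factor, so the copy number, and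
  with it the column, is read off from \<open>p\<close> alone, while the first factor ends away from
  \<open>v\<close> and keeps its column.\<close>

lemma split_matrix_mult:
  assumes f: "f \<in> path_radical" and g: "g \<in> path_radical"
  shows "split_matrix (\<lambda>x. path_conv f (g x)) = (\<lambda>x. dup.path_conv (split_matrix f) (split_matrix g x))"
proof (intro ext)
  fix x z r
  let ?P = "\<lambda>x. dup.path_conv (split_matrix f) (split_matrix g x)"
  \<comment> \<open>Lengths add up, so the product has no constant paths; this settles the entries
    where \<open>split_matrix\<close> is zero by definition.\<close>
  have P: "?P \<in> dup.path_filtration (1 + 1)"
    by (intro dup.path_filtration_mult) (simp_all only: dup.path_filtration_1 split_matrix_closed)
  show "split_matrix (\<lambda>x. path_conv f (g x)) x z r = ?P x z r"
  proof (cases "dup.path_entry x z r \<and> r \<noteq> []")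
    case False
    have "?P x z r = 0"
    proof (rule ccontr)
      assume nz: "?P x z r \<noteq> 0"
      then have "1 + 1 \<le> length r" "dup.path_entry x z r"
        using P unfolding dup.path_filtration_def dup.path_matrices_simps mem_Collect_eq by blast+
      then show False using False by auto
    qed
    then show ?thesis using False by (auto simp: split_matrix_def)
  next
    case True
    then have x: "x \<in> dup.summands" and z: "z \<in> dup.summands" and arcs: "set r \<subseteq> arcs dup_quiver"
      by (auto simp: dup_entry_iff)
    have zero: "g x' y p = 0" "split_matrix g x' y p' = 0" if "fst y = v" for x' y p p'
      using that radical_entryD[OF g, of x' y p] entry_source_not_sink[of x' y p]
        dup_entry_source_not_sink[of x' y p'] by (auto simp: split_matrix_def)
    define T where "T = {y \<in> summands. fst y \<noteq> v}"
    have T': "T = {y \<in> dup.summands. fst y \<noteq> v}" by (auto simp: T_def summands_dup)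
    have "split_matrix (\<lambda>x. path_conv f (g x)) x z r =
        (\<Sum>y\<in>summands. \<Sum>(q, p)\<in>splits (map underlying r). f y z q * g (column x r) y p)"
      using True by (simp add: split_matrix_def path_conv_def)
    also have "\<dots> = (\<Sum>y\<in>T. \<Sum>(q, p)\<in>splits (map underlying r). f y z q * g (column x r) y p)"
      by (rule sum.mono_neutral_right) (auto simp: T_def zero intro!: sum.neutral)
    also have "\<dots> = (\<Sum>y\<in>T. \<Sum>(q, p)\<in>splits r. f y z (map underlying q) * g (column x r) y (map underlying p))"
      by (simp only: sum_splits_map)
    also have "\<dots> = (\<Sum>y\<in>T. \<Sum>(q, p)\<in>splits r. split_matrix f y z q * split_matrix g x y p)"
    proof (intro sum.cong refl, clarify)
      fix y k q p assume "(y, k) \<in> T" "(q, p) \<in> splits r"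
      then obtain w where w: "w = (y, k)" "w \<in> T" and r: "r = q @ p" by (auto simp: splits_def)
      then have wv: "fst w \<noteq> v" and ws: "w \<in> dup.summands" by (auto simp: T')
      have "f w z (map underlying q) * g (column x r) w (map underlying p) = split_matrix f w z q * split_matrix g x w p"
      proof (cases "q = [] \<or> p = []")
        case True
        \<comment> \<open>Radical matrices have no constant paths, so such a cut gives zero on both
          sides.\<close>
        then show ?thesis
          using f g by (auto simp: split_matrix_def path_radical_def)
      next
        case False
        then have col: "column x r = column x p" "column w q = w"
          using r wv by (simp_all add: column_def)
        have fst_col: "fst (column x p) = fst x" by (simp add: column_def)
        \<comment> \<open>The guard in \<open>split_matrix\<close> loses nothing: a nonzero
          coefficient at the underlying path supplies the walk, and the arrows of \<open>q\<close>
          already lie in the new quiver.\<close>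
        have "f w z (map underlying q) = split_matrix f w z q"
          using radical_entryD[OF f, of w z "map underlying q"] False ws z arcs r col
          by (auto simp: split_matrix_def dup_entry_iff path_entry_def)
        moreover have "g (column x r) w (map underlying p) = split_matrix g x w p"
          using radical_entryD[OF g, of "column x p" w "map underlying p"] False ws x arcs r col fst_col
          by (auto simp: split_matrix_def dup_entry_iff path_entry_def)
        ultimately show ?thesis by simp
      qed
      then show "f (y, k) z (map underlying q) * g (column x r) (y, k) (map underlying p) =
          split_matrix f (y, k) z q * split_matrix g x (y, k) p"
        by (simp add: w)
    qed
    \<comment> \<open>Reinstating the summand \<open>(v, 0)\<close> adds only zero terms.\<close>
    also have "\<dots> = (\<Sum>y\<in>dup.summands. \<Sum>(q, p)\<in>splits r. split_matrix f y z q * split_matrix g x y p)"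
      by (rule sum.mono_neutral_left) (auto simp: T' zero intro!: sum.neutral)
    finally show ?thesis by (simp add: dup.path_conv_def)
  qed
qed

lemma split_matrix_isomorphic:
  "ideals_isomorphic (path_radical :: ('v, 'a, 'k::field) path_matrix set) path_matrices
     (dup.path_radical) dup.path_matrices"
  unfolding ideals_isomorphic_def
proof (intro exI[of _ split_matrix] conjI ballI allI split_matrix_bij)
  fix f g :: "('v, 'a, 'k) path_matrix" and c
  assume f: "f \<in> path_radical"
  show "split_matrix (c \<odot>\<^bsub>path_matrices\<^esub> f) = c \<odot>\<^bsub>dup.path_matrices\<^esub> split_matrix f"
    by (auto simp: split_matrix_def fun_eq_iff)
  assume g: "g \<in> path_radical"
  show "split_matrix (f \<oplus>\<^bsub>path_matrices\<^esub> g) = split_matrix f \<oplus>\<^bsub>dup.path_matrices\<^esub> split_matrix g"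
    by (auto simp: split_matrix_def fun_eq_iff)
  show "split_matrix (f \<otimes>\<^bsub>path_matrices\<^esub> g) = split_matrix f \<otimes>\<^bsub>dup.path_matrices\<^esub> split_matrix g"
    using split_matrix_mult[OF f g] by simp
qed

end

theorem corollary3p16:
  fixes Q :: "('v, 'a) pre_digraph" and v :: 'v and d :: "'v \<Rightarrow> nat"
    and K :: "'k::{field, finite} itself"
  assumes "fin_digraph Q" and "acyclic_quiver Q"
    and "v \<in> verts Q" and "out_arcs Q v = {}"
  defines "Q' \<equiv> duplicate_arrows Q v (d v)" and "d' \<equiv> d(v := 1)"
  shows "ideals_isomorphic
           (jacobson_radical (proj_End K Q d)) (proj_End K Q d)
           (jacobson_radical (proj_End K Q' d')) (proj_End K Q' d') \<and>
         commuting_count K Q d = commuting_count K Q' d'"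
proof -
  interpret sink_splitting Q d v
    using assms(1-4) by (intro sink_splitting.intro acyclic_proj_sum.intro
        acyclic_proj_sum_axioms.intro sink_splitting_axioms.intro)
  \<comment> \<open>Both endomorphism algebras are compared through path matrices, so the first
    isomorphism has to be reversed.\<close>
  have "ideals_isomorphic (jacobson_radical (proj_End K Q d)) (proj_End K Q d) path_radical path_matrices"
    by (rule ideals_isomorphic_sym[OF path_matrices_radical_isomorphic])
      (simp_all only: path_matrices_simps path_radical_closed)
  also note split_matrix_isomorphic
  also note dup.path_matrices_radical_isomorphic
  finally have iso: "ideals_isomorphic (jacobson_radical (proj_End K Q d)) (proj_End K Q d)
      (jacobson_radical (proj_End K Q' d')) (proj_End K Q' d')"
    by (simp only: Q'_def d'_def dup_quiver_def dup_mult_def)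
  moreover have "x \<otimes>\<^bsub>proj_End K Q d\<^esub> y \<in> jacobson_radical (proj_End K Q d)"
    if "x \<in> jacobson_radical (proj_End K Q d)" "y \<in> jacobson_radical (proj_End K Q d)" for x y
    using ring.jacobson_radical_mult_closed[OF ring_proj_End _ that(2)] that(1)
    unfolding jacobson_radical_def by blast
  ultimately show ?thesis
    unfolding commuting_count_def using ideals_isomorphic_card_commuting[OF iso] by blast
qed

end
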